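(* Suppose that $0<s_1<s_2\le1$ and let $g$ be an analytic function in $\mathbb{D}$. Then the following conditions are equivalent: (i) $I_g$ maps $Q_{s_2}$ into $Q_{s_1}$. (ii) $M_g$ maps $Q_{s_2}$ into $Q_{s_1}$. (iii) $g\equiv0$.
   Context: $\mathbb{D}$ is the open unit disc in $\mathbb{C}$ and $dA$ is the normalized Lebesgue area measure on $\mathbb{D}$. For $a\in\mathbb{D}$, $\varphi_a(z)=\frac{a-z}{1-\overline{a}z}$. For $0<s<\infty$, $Q_s$ is the space of all analytic $f$ in $\mathbb{D}$ with $\sup_{a\in\mathbb{D}}\int_{\mathbb{D}}|f'(z)|^2 g(z,a)^s\,dA(z)<\infty$, where $g(z,a)=\log\frac{|1-\overline{a}z|}{|a-z|}$ is the Green function; equivalently (a known fact), $\sup_{a\in\mathbb{D}}\int_{\mathbb{D}}|f'(z)|^2(1-|\varphi_a(z)|^2)^s\,dA(z)<\infty$. For $g$ and $f$ analytic in $\mathbb{D}$ and $z\in\mathbb{D}$: $I_g(f)(z)=\int_0^z g(\xi)f'(\xi)\,d\xi$, $M_g(f)(z)=g(z)f(z)$. An operator $T$ maps $X$ into $Y$ if $T(X)\subset Y$. *)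

theory Defs
  imports "HOL-Complex_Analysis.Complex_Analysis"
begin

abbreviation unit_disc :: "complex set" where
  "unit_disc \<equiv> ball 0 1"

definition disc_area :: "complex measure" where
  "disc_area = scale_measure (ennreal (1 / pi)) (restrict_space lborel unit_disc)"

text \<open>At the pole \<open>z = a\<close> the Green function takes the junk value \<open>ln 0 = 0\<close> instead of
  infinity; this is a null set for the area measure.\<close>

definition green :: "complex \<Rightarrow> complex \<Rightarrow> real" where
  "green z a = ln (cmod (1 - cnj a * z) / cmod (a - z))"

text \<open>Functions on the disc are represented by total functions whose values outside the disc are
  irrelevant: \<open>Q_space\<close>, \<open>I_op\<close> and \<open>M_op\<close> on the disc depend only on the restrictions of their
  arguments to the disc.  The integral is a nonnegative extended real, so no integrability is
  presupposed.\<close>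

definition Q_space :: "real \<Rightarrow> (complex \<Rightarrow> complex) set" where
  "Q_space s = {f. f holomorphic_on unit_disc \<and>
     (SUP a\<in>unit_disc. \<integral>\<^sup>+ z. ennreal ((cmod (deriv f z))\<^sup>2 * green z a powr s) \<partial>disc_area) < \<infinity>}"

definition I_op :: "(complex \<Rightarrow> complex) \<Rightarrow> (complex \<Rightarrow> complex) \<Rightarrow> complex \<Rightarrow> complex" where
  "I_op g f z = contour_integral (linepath 0 z) (\<lambda>\<xi>. g \<xi> * deriv f \<xi>)"

definition M_op :: "(complex \<Rightarrow> complex) \<Rightarrow> (complex \<Rightarrow> complex) \<Rightarrow> complex \<Rightarrow> complex" where
  "M_op g f z = g z * f z"

end

theory Submission
  imports Defs
begin

text \<open>
  The radial measure \<open>(1 - |z|) powr (- 2\<beta>) dA\<close> has a finite Green potential of exponent \<open>s\<^sub>2\<close>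
  at the origin when \<open>2\<beta> < 1 + s\<^sub>2\<close>, and the origin is the worst point: Jensen's formula bounds the
  circular mean of \<open>green _ a\<close> by \<open>ln (1 / |z|)\<close>, and \<open>x powr s\<^sub>2\<close> is concave as \<open>s\<^sub>2 \<le> 1\<close>.  Hence
  \<open>|f' z| \<le> C (1 - |z|) powr (- \<beta>)\<close> puts \<open>f\<close> into \<open>Q_space s\<^sub>2\<close>.  For
  \<open>(1 + s\<^sub>1)/2 < \<alpha> < \<beta> < (1 + s\<^sub>2)/2\<close> a bounded lacunary series \<open>f\<close> satisfies this bound together with
  \<open>|f' z| \<ge> n powr \<alpha> / 5\<close> on the annuli \<open>|z| \<approx> 1 - 1/n\<close>, \<open>n = 10000 ^ k\<close>.  If \<open>g\<close> does not vanish
  identically, then the circular means of \<open>|g|\<^sup>2\<close> are bounded below near the boundary by a Taylor coefficient,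
  so \<open>g f'\<close> is not square integrable for the weight \<open>(1 - |z|) powr s\<^sub>1\<close> and \<open>I_op g f\<close> is not in
  \<open>Q_space s\<^sub>1\<close>.  For \<open>M_op g\<close> the remaining term \<open>g' f\<close> of the derivative is harmless, because
  \<open>f\<close> is bounded and \<open>g = M_op g 1\<close> lies in \<open>Q_space s\<^sub>1\<close>.
\<close>

unbundle no fps_syntax

subsection \<open>Rotation invariance of Lebesgue measure on the complex plane\<close>

text \<open>Both sides give every box the product of its side lengths, and this determines Lebesgue
  measure. The passage to \<open>real^2\<close> makes the measure theory of orthogonal
  transformations available for complex numbers.\<close>

lemma lborel_complex_eq_distr: "(lborel :: complex measure) = distr (lborel :: (real^2) measure) borel (\<lambda>v. Complex (v $ 1) (v $ 2))"
proof (rule lborel_eqI)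
  fix l u :: complex
  assume le: "\<And>b. b \<in> Basis \<Longrightarrow> l \<bullet> b \<le> u \<bullet> b"
  let ?J = "\<lambda>v::real^2. Complex (v $ 1) (v $ 2)"
  have le': "Re l \<le> Re u" "Im l \<le> Im u"
    using le[of 1] le[of \<i>] by (auto simp: Basis_complex_def inner_complex_def)
  have m: "?J \<in> borel_measurable lborel"
    by (simp, intro borel_measurable_continuous_onI) (auto intro!: continuous_intros simp: Complex_eq)
  let ?L = "vector [Re l, Im l] :: real^2" and ?U = "vector [Re u, Im u] :: real^2"
  have B2: "Basis = {axis 1 1, axis 2 1 :: real^2}"
    by (auto simp: Basis_vec_def UNIV_2)
  have "?J -` box l u = box ?L ?U"
    by (auto simp: box_Complex_eq mem_box_cart forall_2 in_box_complex_iff)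
  then have "emeasure (distr lborel borel ?J) (box l u) = emeasure lborel (box ?L ?U)"
    using m by (simp add: emeasure_distr)
  also have "\<dots> = (\<Prod>b\<in>Basis. (?U - ?L) \<bullet> b)"
    using le' by (intro emeasure_lborel_box) (auto simp: B2 inner_axis)
  also have "\<dots> = (\<Prod>b\<in>Basis. (u - l) \<bullet> b)"
    using le' by (simp add: B2 inner_axis Basis_complex_def inner_complex_def axis_eq_axis)
  finally show "emeasure (distr lborel borel ?J) (box l u) = (\<Prod>b\<in>Basis. (u - l) \<bullet> b)" .
qed simp

text \<open>Multiplication by \<open>c\<close> is an isometry. In real coordinates the preimage of a
  box under it is the image of a box under an orthogonal map, which preserves measure; boxes again
  determine the measure.\<close>

lemma distr_lborel_unimodular_mult:
  assumes "cmod c = 1"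
  shows "distr (lborel::complex measure) borel ((*) c) = lborel"
proof (rule lborel_eqI[symmetric])
  fix l u :: complex
  assume le: "\<And>b. b \<in> Basis \<Longrightarrow> l \<bullet> b \<le> u \<bullet> b"
  let ?J = "\<lambda>v::real^2. Complex (v $ 1) (v $ 2)"
  \<comment> \<open>Multiplication by \<open>cnj c\<close>, the inverse of \<open>c\<close>, in real
    coordinates: preimages under \<open>c\<close> become images under \<open>R\<close>.\<close>
  define R where "R = (\<lambda>v::real^2. vector [Re (cnj c * ?J v), Im (cnj c * ?J v)] :: real^2)"
  have JR: "?J (R v) = cnj c * ?J v" for v
    by (simp add: R_def complex_eq_iff)
  let ?B = "?J -` box l u"
  have cc: "cnj c * c = 1"
    using assms by (metis complex_norm_square mult.commute of_real_1 one_power2)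
  have ortho: "orthogonal_transformation R"
    unfolding orthogonal_transformation
  proof
    show "linear R"
      by (rule linearI) (auto simp: R_def vec_eq_iff forall_2 algebra_simps)
    have "norm v = cmod (?J v)" for v
      by (simp add: norm_vec_def L2_set_def sum_2 cmod_def)
    then show "\<forall>v. norm (R v) = norm v"
      using assms by (simp add: JR norm_mult)
  qed
  have pre: "?J -` ((*) c -` box l u) = R ` ?B"
  proof (intro equalityI subsetI)
    fix v assume v: "v \<in> ?J -` ((*) c -` box l u)"
    define w where "w = (vector [Re (c * ?J v), Im (c * ?J v)] :: real^2)"
    have w: "?J w = c * ?J v"
      by (simp add: w_def complex_eq_iff)
    have "?J (R w) = ?J v"
      unfolding JR w using cc by (simp add: mult.assoc[symmetric])
    then have "R w = v"
      by (simp add: vec_eq_iff forall_2)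
    moreover have "w \<in> ?B" using v w by simp
    ultimately show "v \<in> R ` ?B" by blast
  next
    fix v assume "v \<in> R ` ?B"
    then obtain w where "v = R w" "?J w \<in> box l u" by auto
    then show "v \<in> ?J -` ((*) c -` box l u)"
      using cc by (simp add: JR mult.assoc[symmetric] mult.commute[of c])
  qed
  have cont: "continuous_on UNIV ?J" by (auto intro!: continuous_intros simp: Complex_eq)
  have mJ: "?J \<in> borel_measurable borel" by (intro borel_measurable_continuous_onI cont)
  have mc: "(*) c \<in> borel_measurable borel" by (intro borel_measurable_continuous_onI continuous_intros)
  have eJ: "emeasure lborel S = emeasure lborel (?J -` S)" if "S \<in> sets borel" for S
    by (subst lborel_complex_eq_distr) (simp add: emeasure_distr mJ that)
  have "?B = box (vector [Re l, Im l]) (vector [Re u, Im u])"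
    by (auto simp: mem_box_cart forall_2 in_box_complex_iff)
  then have B: "?B \<in> lmeasurable" "?B \<in> sets borel"
    by simp_all
  have RB: "R ` ?B \<in> lmeasurable" "R ` ?B \<in> sets borel"
    using measurable_orthogonal_image[OF ortho B(1)] measurable_sets_borel[OF mJ measurable_sets_borel[OF mc, of "box l u"]] pre
    by simp_all
  have "emeasure (distr lborel borel ((*) c)) (box l u) = emeasure lborel ((*) c -` box l u)"
    using mc by (simp add: emeasure_distr)
  also have "\<dots> = emeasure lborel (R ` ?B)"
    using eJ[of "(*) c -` box l u"] mc pre by (simp add: measurable_sets_borel)
  also have "\<dots> = emeasure lborel ?B"
  proof -
    have "emeasure lborel (R ` ?B) = emeasure lebesgue (R ` ?B)"
      using RB(2) by simp
    also have "\<dots> = emeasure lebesgue ?B"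
      by (simp only: emeasure_eq_measure2[OF RB(1)] emeasure_eq_measure2[OF B(1)]
          measure_orthogonal_image[OF ortho B(1)])
    finally show ?thesis using B(2) by simp
  qed
  also have "\<dots> = emeasure lborel (box l u)"
    by (simp add: eJ)
  finally show "emeasure (distr lborel borel ((*) c)) (box l u) = (\<Prod>b\<in>Basis. (u - l) \<bullet> b)"
    using le by (simp add: emeasure_lborel_box)
qed simp

subsection \<open>Circular means\<close>

lemma nn_integral_lborel_rotation:
  fixes F :: "complex \<Rightarrow> ennreal"
  assumes "F \<in> borel_measurable borel" "cmod c = 1"
  shows "(\<integral>\<^sup>+z. F (c * z) \<partial>lborel) = (\<integral>\<^sup>+z. F z \<partial>lborel)"
proof -
  have "(*) c \<in> borel_measurable borel"
    by (intro borel_measurable_continuous_onI continuous_intros)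
  then have "(\<integral>\<^sup>+z. F z \<partial>distr lborel borel ((*) c)) = (\<integral>\<^sup>+z. F (c * z) \<partial>lborel)"
    using assms by (simp add: nn_integral_distr)
  then show ?thesis
    using distr_lborel_unimodular_mult[OF assms(2)] by simp
qed

text \<open>This takes the place of polar coordinates. By Fubini the average over \<open>t\<close>
  can be taken last, and for each fixed \<open>t\<close> a rotation does not change the integral
  over the plane.\<close>

lemma nn_integral_circle_average:
  fixes F :: "complex \<Rightarrow> ennreal"
  assumes [measurable]: "F \<in> borel_measurable borel"
  shows "(\<integral>\<^sup>+z. F z \<partial>lborel) =
    (\<integral>\<^sup>+z. (\<integral>\<^sup>+t\<in>{0..1}. F (z * cis (2 * pi * t)) \<partial>lborel) \<partial>lborel)"
proof -
  have "continuous_on UNIV (\<lambda>p::complex \<times> real. fst p * cis (2 * pi * snd p))"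
    by (intro continuous_intros)
  then have [measurable]: "(\<lambda>p::complex \<times> real. fst p * cis (2 * pi * snd p)) \<in> borel_measurable (lborel \<Otimes>\<^sub>M lborel)"
    by (simp add: borel_measurable_continuous_onI lborel_prod)
  have "(\<integral>\<^sup>+z. (\<integral>\<^sup>+t\<in>{0..1}. F (z * cis (2 * pi * t)) \<partial>lborel) \<partial>lborel)
      = (\<integral>\<^sup>+t. (\<integral>\<^sup>+z. F (z * cis (2 * pi * t)) * indicator {0..1} t \<partial>lborel) \<partial>lborel)"
    by (rule lborel_pair.Fubini'[symmetric]) (simp add: case_prod_beta)
  also have "\<dots> = (\<integral>\<^sup>+t. (\<integral>\<^sup>+z. F z \<partial>lborel) * indicator {0..1::real} t \<partial>lborel)"
    by (subst nn_integral_multc)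
       (simp_all add: nn_integral_lborel_rotation mult.commute[of _ "cis _"])
  also have "\<dots> = (\<integral>\<^sup>+z. F z \<partial>lborel)"
    by (simp add: nn_integral_cmult_indicator)
  finally show ?thesis ..
qed

text \<open>Cauchy's formula for the \<open>k\<close>-th derivative on the unit circle; the velocity
  of the parametrisation cancels one factor of the denominator.\<close>

lemma has_integral_circle_coefficient:
  assumes "f holomorphic_on ball 0 R" "1 < R"
  shows "((\<lambda>t. f (cis (2 * pi * t)) * cis (- (2 * pi * real k * t)))
    has_integral (deriv ^^ k) f 0 / fact k) {0..1}"
proof -
  have "cball 0 1 \<subseteq> ball (0::complex) R" "ball 0 1 \<subseteq> ball (0::complex) R"
    using assms(2) by auto
  then have "continuous_on (cball 0 1) f" "f holomorphic_on ball 0 1"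
    using assms(1) by (meson holomorphic_on_subset holomorphic_on_imp_continuous_on)+
  then have "((\<lambda>u. f u / (u - 0) ^ Suc k) has_contour_integral
      (2 * pi * \<i>) / fact k * (deriv ^^ k) f 0) (circlepath 0 1)"
    by (intro Cauchy_has_contour_integral_higher_derivative_circlepath) auto
  then have "((\<lambda>t. f (cis (2 * pi * t)) / cis (2 * pi * t) ^ Suc k * (2 * pi * \<i> * cis (2 * pi * t)))
      has_integral (2 * pi * \<i>) / fact k * (deriv ^^ k) f 0) {0..1}"
    unfolding has_contour_integral_def
    by (rule has_integral_eq[rotated])
      (simp add: vector_derivative_circlepath01, simp add: circlepath cis_conv_exp mult_ac)
  then have "((\<lambda>t. f (cis (2 * pi * t)) / cis (2 * pi * t) ^ Suc k * (2 * pi * \<i> * cis (2 * pi * t)) / (2 * pi * \<i>))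
      has_integral (2 * pi * \<i>) / fact k * (deriv ^^ k) f 0 / (2 * pi * \<i>)) {0..1}"
    by (rule has_integral_divide)
  moreover have "f (cis (2 * pi * t)) / cis (2 * pi * t) ^ Suc k * (2 * pi * \<i> * cis (2 * pi * t)) / (2 * pi * \<i>)
     = f (cis (2 * pi * t)) * cis (- (2 * pi * real k * t))" for t :: real
  proof -
    have "cis (2 * pi * t) ^ k * cis (- (2 * pi * real k * t)) = 1"
      unfolding Complex.DeMoivre cis_mult by (simp add: algebra_simps flip: cis_zero)
    then show ?thesis by (simp add: field_simps)
  qed
  ultimately show ?thesis
    by simp
qed

text \<open>The integrand is the real part of \<open>Ln (1 - w * u)\<close> on the unit circle, and
  this function is holomorphic beyond the closed disc and vanishes at 0. The mean value property,
  case \<open>k = 0\<close> of the coefficient formula, gives the claim.\<close>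

lemma has_integral_ln_circle_eq_0:
  assumes "cmod w < 1"
  shows "((\<lambda>t. ln (cmod (1 - w * cis (2 * pi * t)))) has_integral 0) {0..1}"
proof -
  \<comment> \<open>A radius above 1 with \<open>cmod w * R < 1\<close>; this choice covers
    \<open>w = 0\<close> as well.\<close>
  define R where "R = 2 / (1 + cmod w)"
  have "0 \<le> cmod w" by simp
  then have R: "1 < R" and wR: "cmod w * R < 1"
    using assms by (simp_all only: R_def) (simp_all add: field_simps add_pos_nonneg)
  have "1 - w * u \<notin> \<real>\<^sub>\<le>\<^sub>0" if "cmod u < R" for u
  proof -
    have "cmod (w * u) < 1"
      using mult_left_mono[OF less_imp_le[OF that], of "cmod w"] wR by (simp add: norm_mult)
    then have "Re (w * u) < 1"
      using complex_Re_le_cmod[of "w * u"] by linarith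
    then show ?thesis by (auto simp: complex_nonpos_Reals_iff)
  qed
  then have "(\<lambda>u. Ln (1 - w * u)) holomorphic_on ball 0 R"
    by (intro holomorphic_intros) auto
  from has_integral_circle_coefficient[OF this R, of 0]
  have "((\<lambda>t. Ln (1 - w * cis (2 * pi * t))) has_integral 0) {0..1}"
    by simp
  then have "((\<lambda>t. Re (Ln (1 - w * cis (2 * pi * t)))) has_integral 0) {0..1}"
    by (metis has_integral_Re zero_complex.sel(1))
  moreover have "1 - w * cis (2 * pi * t) \<noteq> 0" for t :: real
  proof
    assume "1 - w * cis (2 * pi * t) = 0"
    then have "w * cis (2 * pi * t) = 1" by simp
    from arg_cong[OF this, of cmod] have "cmod w = 1" by (simp add: norm_mult)
    with assms show False by simp
  qed
  ultimately show ?thesis by simp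
qed

subsection \<open>Green potentials of radial measures\<close>

lemma measurable_green [measurable]: "(\<lambda>z. green z a) \<in> borel_measurable borel"
  unfolding green_def by measurable

text \<open>The quotient under the logarithm is at least 1, because the squares of its numerator and
  denominator differ by \<open>(1 - |a|^2) * (1 - |z|^2)\<close>. At the pole the value is
  \<open>ln 0 = 0\<close>.\<close>

lemma green_nonneg:
  assumes "cmod z < 1" "cmod a < 1"
  shows "0 \<le> green z a"
proof (cases "a = z")
  case False
  have "(cmod (a - z))\<^sup>2 \<le> (cmod (1 - cnj a * z))\<^sup>2"
  proof -
    have "(cmod (1 - cnj a * z))\<^sup>2 - (cmod (a - z))\<^sup>2 = (1 - (cmod a)\<^sup>2) * (1 - (cmod z)\<^sup>2)"
      unfolding cmod_power2 by (simp add: power2_eq_square algebra_simps)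
    moreover have "0 \<le> (1 - (cmod a)\<^sup>2) * (1 - (cmod z)\<^sup>2)"
      using assms by (intro mult_nonneg_nonneg) (simp_all add: abs_square_le_1)
    ultimately show ?thesis by linarith
  qed
  then have "cmod (a - z) \<le> cmod (1 - cnj a * z)"
    by (rule power2_le_imp_le) simp
  then show ?thesis
    using False by (simp add: green_def)
qed (simp add: green_def)

lemma AE_lborel_norm_neq:
  "AE z in lborel. norm (z::'a::euclidean_space) \<noteq> r"
proof -
  have "sphere (0::'a) r \<in> null_sets lborel"
    using negligible_sphere[of "0::'a" r]
    by (simp add: negligible_iff_null_sets null_sets_completion_iff)
  from AE_not_in[OF this] show ?thesis by auto
qed

text \<open>The mean is in fact \<open>- ln R\<close> with \<open>R\<close> the larger of
  \<open>cmod a\<close> and \<open>cmod z\<close>. After \<open>R\<close> is factored out of the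
  denominator, both logarithms have the form \<open>ln (cmod (1 - v * cis x))\<close> with
  \<open>cmod v < 1\<close>, hence mean 0. On the circle through the pole this factorisation would
  give \<open>cmod w = 1\<close>, so that radius is excluded.\<close>

lemma green_circle_mean:
  assumes z: "z \<noteq> 0" "cmod z < 1" and a: "cmod a < 1" and neq: "cmod z \<noteq> cmod a"
  shows "(\<integral>\<^sup>+t\<in>{0..1}. ennreal (green (z * cis (2 * pi * t)) a) \<partial>lborel) \<le> ennreal (ln (1 / cmod z))"
proof -
  define R where "R = max (cmod a) (cmod z)"
  \<comment> \<open>The smaller modulus over the larger. The conjugate for
    \<open>cmod a < cmod z\<close> turns the inverse of \<open>cis x\<close> back into
    \<open>cis x\<close>.\<close>
  define w where "w = (if cmod a < cmod z then cnj (a / z) else z / a)"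
  have R: "cmod z \<le> R" "0 < R" using z by (auto simp: R_def less_max_iff_disj)
  have w: "cmod w < 1"
    using neq by (auto simp: w_def norm_divide divide_simps)
  have mod_a: "cmod (a - z * cis x) = R * cmod (1 - w * cis x)" for x
  proof (cases "cmod a < cmod z")
    case True
    have "cmod (a - z * cis x) = cmod (z * cis x) * cmod (1 - a / z * cnj (cis x))"
      unfolding norm_mult[symmetric] norm_minus_commute[of a]
      using z(1) by (simp add: algebra_simps) (simp add: cis_cnj cis_mult flip: mult.assoc)
    also have "cmod (1 - a / z * cnj (cis x)) = cmod (cnj (1 - a / z * cnj (cis x)))"
      by (simp only: complex_mod_cnj)
    finally show ?thesis
      using True by (simp add: w_def R_def norm_mult)
  next
    case False
    then have "a \<noteq> 0" using neq by auto
    then have "a - z * cis x = a * (1 - z / a * cis x)"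
      by (simp add: algebra_simps)
    then show ?thesis
      using False by (simp add: w_def R_def norm_mult)
  qed
  have nz: "cmod (1 - v * cis x) \<noteq> 0" if "cmod v < 1" for v x
  proof
    assume "cmod (1 - v * cis x) = 0"
    then have "v * cis x = 1" by simp
    from arg_cong[OF this, of cmod] that show False by (simp add: norm_mult)
  qed
  have az: "cmod (cnj a * z) < 1"
    using mult_strict_mono'[of "cmod a" 1 "cmod z" 1] z a by (simp add: norm_mult)
  have "green (z * cis (2 * pi * t)) a
      = ln (cmod (1 - cnj a * z * cis (2 * pi * t))) - (ln R + ln (cmod (1 - w * cis (2 * pi * t))))" for t
    unfolding green_def mod_a
    using nz[OF az] nz[OF w] R by (simp add: ln_div ln_mult mult.assoc)
  moreover have "((\<lambda>t. ln (cmod (1 - cnj a * z * cis (2 * pi * t))) - (ln R + ln (cmod (1 - w * cis (2 * pi * t)))))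
      has_integral 0 - (ln R + 0)) {0..1}"
    using has_integral_const_real[of "ln R" 0 1]
    by (intro has_integral_diff has_integral_add has_integral_ln_circle_eq_0 az w) simp_all
  ultimately have "((\<lambda>t. green (z * cis (2 * pi * t)) a) has_integral - ln R) {0..1}"
    by simp
  then have "(\<integral>\<^sup>+t\<in>{0..1}. ennreal (green (z * cis (2 * pi * t)) a) \<partial>lborel) = ennreal (- ln R)"
    using z a by (intro nn_integral_has_integral_lebesgue' green_nonneg) (simp_all add: norm_mult)
  also have "\<dots> \<le> ennreal (ln (1 / cmod z))"
    using R z by (intro ennreal_leI) (simp add: ln_div)
  finally show ?thesis .
qed

text \<open>The factor \<open>V (cmod z)\<close> is constant on circles about 0, so after averaging
  over circles it leaves the inner integral and only the circular mean of the Green function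
  remains.\<close>

lemma green_potential_le:
  fixes V :: "real \<Rightarrow> real"
  assumes [measurable]: "V \<in> borel_measurable borel" and V: "\<And>r. 0 \<le> V r" and a: "cmod a < 1"
  shows "(\<integral>\<^sup>+z\<in>unit_disc. ennreal (V (cmod z) * green z a) \<partial>lborel)
       \<le> (\<integral>\<^sup>+z\<in>unit_disc. ennreal (V (cmod z) * ln (1 / cmod z)) \<partial>lborel)"
proof -
  have [measurable]: "unit_disc \<in> sets borel" by simp
  have "(\<integral>\<^sup>+z\<in>unit_disc. ennreal (V (cmod z) * green z a) \<partial>lborel)
      = (\<integral>\<^sup>+z. (\<integral>\<^sup>+t\<in>{0..1}. ennreal (V (cmod (z * cis (2 * pi * t))) * green (z * cis (2 * pi * t)) a) * indicator unit_disc (z * cis (2 * pi * t)) \<partial>lborel) \<partial>lborel)"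
    by (rule nn_integral_circle_average) measurable
  also have "\<dots> \<le> (\<integral>\<^sup>+z\<in>unit_disc. ennreal (V (cmod z) * ln (1 / cmod z)) \<partial>lborel)"
  proof (rule nn_integral_mono_AE)
    show "AE z in lborel. (\<integral>\<^sup>+t\<in>{0..1}. ennreal (V (cmod (z * cis (2 * pi * t))) * green (z * cis (2 * pi * t)) a) * indicator unit_disc (z * cis (2 * pi * t)) \<partial>lborel)
       \<le> ennreal (V (cmod z) * ln (1 / cmod z)) * indicator unit_disc z"
      \<comment> \<open>The circle through the pole and the origin are null sets; off them the bound
        on the circular mean applies.\<close>
      using AE_lborel_norm_neq[where r="cmod a" and 'a = complex] AE_lborel_singleton[of "0::complex"]
    proof eventually_elim
      case (elim z)
      show ?case
      proof (cases "cmod z < 1")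
        case True
        have cis_m [measurable]: "(\<lambda>t. z * cis (2 * pi * t)) \<in> borel_measurable borel"
          by (intro borel_measurable_continuous_onI continuous_intros)
        have "(\<integral>\<^sup>+t\<in>{0..1}. ennreal (V (cmod (z * cis (2 * pi * t))) * green (z * cis (2 * pi * t)) a) * indicator unit_disc (z * cis (2 * pi * t)) \<partial>lborel)
           = (\<integral>\<^sup>+t. ennreal (V (cmod z)) * (ennreal (green (z * cis (2 * pi * t)) a) * indicator {0..1} t) \<partial>lborel)"
          using True V a by (intro nn_integral_cong) (simp add: norm_mult ennreal_mult' mult.assoc)
        also have "\<dots> = ennreal (V (cmod z)) * (\<integral>\<^sup>+t\<in>{0..1}. ennreal (green (z * cis (2 * pi * t)) a) \<partial>lborel)"
          by (rule nn_integral_cmult) measurable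
        also have "\<dots> \<le> ennreal (V (cmod z)) * ennreal (ln (1 / cmod z))"
          using elim True a by (intro mult_left_mono green_circle_mean) auto
        finally show ?thesis
          using True V by (simp add: ennreal_mult')
      qed (simp add: norm_mult)
    qed
  qed
  finally show ?thesis .
qed

text \<open>The right side is the tangent at \<open>m\<close> of the concave function
  \<open>x powr s\<close>. The inequality is Young's inequality for \<open>x\<close> and
  \<open>m\<close>, multiplied by \<open>m powr (s - 1)\<close>.\<close>

lemma powr_le_tangent:
  fixes x m s :: real
  assumes "0 \<le> x" "0 < m" "0 < s" "s \<le> 1"
  shows "x powr s \<le> s * m powr (s - 1) * x + (1 - s) * m powr s"
proof (cases "x = 0")
  case False
  have "x powr s * m powr (1 - s) \<le> s * x + (1 - s) * m"
    using assms False by (intro Youngs_inequality_0) auto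
  then have "x powr s * m powr (1 - s) * m powr (s - 1) \<le> (s * x + (1 - s) * m) * m powr (s - 1)"
    by (rule mult_right_mono) simp
  also have "x powr s * m powr (1 - s) * m powr (s - 1) = x powr s"
    using assms by (simp add: mult.assoc flip: powr_add)
  also have "(s * x + (1 - s) * m) * m powr (s - 1) = s * m powr (s - 1) * x + (1 - s) * m powr s"
    using assms by (simp add: powr_diff field_simps)
  finally show ?thesis .
qed (use assms in simp)

text \<open>Jensen's inequality for the concave power, in tangent form: at \<open>z\<close> the
  tangent is taken at \<open>ln (1 / cmod z)\<close>, the bound for the circular mean. The power
  then becomes an affine function of the Green function with radial coefficients, so that
  \<open>green_potential_le\<close> applies.\<close>

lemma green_powr_potential_le:
  fixes W :: "real \<Rightarrow> real"
  assumes [measurable]: "W \<in> borel_measurable borel" and W: "\<And>r. 0 \<le> W r"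
    and a: "cmod a < 1" and s: "0 < s" "s \<le> 1"
  shows "(\<integral>\<^sup>+z\<in>unit_disc. ennreal (W (cmod z) * green z a powr s) \<partial>lborel)
       \<le> (\<integral>\<^sup>+z\<in>unit_disc. ennreal (W (cmod z) * ln (1 / cmod z) powr s) \<partial>lborel)"
proof -
  \<comment> \<open>\<open>V\<close> and \<open>U\<close> are the slope and the intercept of the
    tangent at \<open>ln (1 / r)\<close>, times \<open>W r\<close>.\<close>
  define V where "V r = W r * (s * ln (1 / r) powr (s - 1))" for r
  define U where "U r = W r * ((1 - s) * ln (1 / r) powr s)" for r
  have [measurable]: "V \<in> borel_measurable borel" "U \<in> borel_measurable borel"
    unfolding V_def U_def by measurable
  have [measurable]: "unit_disc \<in> sets borel" by simp
  have VU: "0 \<le> V r" "0 \<le> U r" for r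
    using W s by (simp_all add: V_def U_def)
  have "(\<integral>\<^sup>+z\<in>unit_disc. ennreal (W (cmod z) * green z a powr s) \<partial>lborel)
     \<le> (\<integral>\<^sup>+z. ennreal (V (cmod z) * green z a) * indicator unit_disc z + ennreal (U (cmod z)) * indicator unit_disc z \<partial>lborel)"
  proof (rule nn_integral_mono_AE)
    show "AE z in lborel. ennreal (W (cmod z) * green z a powr s) * indicator unit_disc z
        \<le> ennreal (V (cmod z) * green z a) * indicator unit_disc z + ennreal (U (cmod z)) * indicator unit_disc z"
      using AE_lborel_singleton[of "0::complex"]
    proof eventually_elim
      case (elim z)
      show ?case
      proof (cases "cmod z < 1")
        case True
        have "green z a powr s \<le> s * ln (1 / cmod z) powr (s - 1) * green z a + (1 - s) * ln (1 / cmod z) powr s"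
          using True elim s green_nonneg[OF True a] by (intro powr_le_tangent) auto
        from mult_left_mono[OF this W[of "cmod z"]]
        have "W (cmod z) * green z a powr s \<le> V (cmod z) * green z a + U (cmod z)"
          by (simp add: V_def U_def algebra_simps)
        then show ?thesis
          using True VU green_nonneg[OF True a] by (simp add: ennreal_leI flip: ennreal_plus)
      qed simp
    qed
  qed
  also have "\<dots> = (\<integral>\<^sup>+z\<in>unit_disc. ennreal (V (cmod z) * green z a) \<partial>lborel) + (\<integral>\<^sup>+z\<in>unit_disc. ennreal (U (cmod z)) \<partial>lborel)"
    by (rule nn_integral_add) measurable
  also have "\<dots> \<le> (\<integral>\<^sup>+z\<in>unit_disc. ennreal (V (cmod z) * ln (1 / cmod z)) \<partial>lborel) + (\<integral>\<^sup>+z\<in>unit_disc. ennreal (U (cmod z)) \<partial>lborel)"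
    by (intro add_right_mono green_potential_le VU a) measurable
  also have "\<dots> = (\<integral>\<^sup>+z. ennreal (V (cmod z) * ln (1 / cmod z)) * indicator unit_disc z + ennreal (U (cmod z)) * indicator unit_disc z \<partial>lborel)"
    by (rule nn_integral_add[symmetric]) measurable
  also have "\<dots> = (\<integral>\<^sup>+z\<in>unit_disc. ennreal (W (cmod z) * ln (1 / cmod z) powr s) \<partial>lborel)"
  proof (rule nn_integral_cong_AE)
    show "AE z in lborel. ennreal (V (cmod z) * ln (1 / cmod z)) * indicator unit_disc z + ennreal (U (cmod z)) * indicator unit_disc z
        = ennreal (W (cmod z) * ln (1 / cmod z) powr s) * indicator unit_disc z"
      using AE_lborel_singleton[of "0::complex"]
    proof eventually_elim
      case (elim z)
      show ?case
      proof (cases "cmod z < 1")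
        case True
        then have m: "0 < ln (1 / cmod z)" using elim by simp
        \<comment> \<open>The tangent meets the curve at the point of tangency, so nothing is lost
          here.\<close>
        have "V (cmod z) * ln (1 / cmod z) + U (cmod z) = W (cmod z) * ln (1 / cmod z) powr s"
          using m by (simp add: V_def U_def powr_diff algebra_simps del: ln_div)
        then show ?thesis
          using True VU m by (simp flip: ennreal_plus)
      qed simp
    qed
  qed
  finally show ?thesis .
qed

section \<open>Finiteness of radial integrals by dyadic layers\<close>

lemma nn_integral_layers_finite:
  fixes f :: "'a \<Rightarrow> real" and c m :: "nat \<Rightarrow> real"
  assumes [measurable]: "\<And>k. A k \<in> sets M"
    and A: "\<And>k. emeasure M (A k) \<le> ennreal (m k)"
    and c: "\<And>k. 0 \<le> c k" and m: "\<And>k. 0 \<le> m k" and sm: "summable (\<lambda>k. c k * m k)"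
    and f: "\<And>x. x \<in> S \<Longrightarrow> \<exists>k. x \<in> A k \<and> f x \<le> c k"
  shows "(\<integral>\<^sup>+x\<in>S. ennreal (f x) \<partial>M) < \<infinity>"
proof -
  \<comment> \<open>The layers may overlap: for an upper bound it is enough that one term of the
    series already dominates \<open>f x\<close>.\<close>
  have "(\<integral>\<^sup>+x\<in>S. ennreal (f x) \<partial>M) \<le> (\<integral>\<^sup>+x. (\<Sum>k. ennreal (c k) * indicator (A k) x) \<partial>M)"
  proof (intro nn_integral_mono)
    fix x
    show "ennreal (f x) * indicator S x \<le> (\<Sum>k. ennreal (c k) * indicator (A k) x)"
    proof (cases "x \<in> S")
      case True
      then obtain k where k: "x \<in> A k" "f x \<le> c k" using f by blast
      have "ennreal (f x) \<le> (\<Sum>i\<in>{k}. ennreal (c i) * indicator (A i) x)"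
        using k by (simp add: ennreal_leI)
      also have "\<dots> \<le> (\<Sum>k. ennreal (c k) * indicator (A k) x)"
        by (rule sum_le_suminf) auto
      finally show ?thesis using True by simp
    qed simp
  qed
  also have "\<dots> = (\<Sum>k. ennreal (c k) * emeasure M (A k))"
    by (simp add: nn_integral_suminf nn_integral_cmult_indicator)
  also have "\<dots> \<le> (\<Sum>k. ennreal (c k * m k))"
    using A c m by (intro suminf_le) (auto simp: ennreal_mult mult_left_mono)
  also have "\<dots> < \<infinity>"
    using c m by (simp add: suminf_ennreal2[OF _ sm])
  finally show ?thesis .
qed

lemma exists_dyadic_scale:
  fixes x :: real
  assumes "0 < x" "x \<le> 1"
  obtains k where "1 / 2 ^ Suc k < x" "x \<le> 1 / 2 ^ k"
proof -
  define P where "P k \<longleftrightarrow> (1 / 2) ^ Suc k < x" for k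
  obtain n where "(1 / 2) ^ n < x"
    using real_arch_pow_inv[of x "1/2"] assms by auto
  moreover have "(1 / 2) ^ Suc n \<le> (1 / 2 :: real) ^ n" by simp
  ultimately have "P n" unfolding P_def by linarith
  then have k: "P (LEAST k. P k)" by (rule LeastI)
  have "x \<le> (1 / 2) ^ (LEAST k. P k)"
  proof (cases "LEAST k. P k")
    case (Suc j)
    then have "\<not> P j" using not_less_Least[of j P] by simp
    then show ?thesis using Suc by (simp add: P_def)
  qed (use assms in simp)
  then show thesis using that k by (simp add: P_def power_one_over)
qed

lemma emeasure_lborel_ball_complex:
  "0 \<le> r \<Longrightarrow> emeasure lborel (ball (c::complex) r) = ennreal (pi * r\<^sup>2)"
  by (simp add: emeasure_ball unit_ball_vol_2)

lemma emeasure_lborel_annulus: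
  assumes "0 \<le> r" "r \<le> R"
  shows "emeasure lborel (ball (c::complex) R - ball c r) = ennreal (pi * (R\<^sup>2 - r\<^sup>2))"
  using assms emeasure_lborel_ball_complex[of r c]
  by (subst emeasure_Diff)
     (auto simp: emeasure_lborel_ball_complex right_diff_distrib simp flip: ennreal_minus)

text \<open>The disc of radius \<open>1 / 2 ^ k\<close> has area of order \<open>1 / 4 ^ k\<close>,
  while outside the next smaller disc the integrand is below \<open>2 ^ Suc k\<close>; the products
  form a geometric series.\<close>

lemma nn_integral_inverse_norm_finite:
  "(\<integral>\<^sup>+z\<in>unit_disc. ennreal (1 / cmod z) \<partial>lborel) < \<infinity>"
proof (rule nn_integral_layers_finite)
  let ?A = "\<lambda>k. cball (0::complex) (1 / 2 ^ k)"
  show "emeasure lborel (?A k) \<le> ennreal (pi * (1 / 2 ^ k)\<^sup>2)" for k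
    by (simp add: emeasure_cball unit_ball_vol_2)
  have "2 ^ Suc k * (pi * (1 / 2 ^ k)\<^sup>2) = 2 * pi * (1 / 2) ^ k" for k :: nat
    by (simp add: power2_eq_square field_simps)
  then show "summable (\<lambda>k. 2 ^ Suc k * (pi * (1 / 2 ^ k)\<^sup>2))"
    by (simp only:) (intro summable_mult summable_geometric, simp)
  fix z :: complex assume z: "z \<in> unit_disc"
  show "\<exists>k. z \<in> ?A k \<and> 1 / cmod z \<le> 2 ^ Suc k"
  proof (cases "z = 0")
    case False
    then obtain k where "1 / 2 ^ Suc k < cmod z" "cmod z \<le> 1 / 2 ^ k"
      using z exists_dyadic_scale[of "cmod z"] by auto
    then show ?thesis using False by (intro exI[of _ k]) (simp add: field_simps)
  \<comment> \<open>Since \<open>1 / 0 = 0\<close>, the origin fits into layer 0.\<close>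
  qed (auto intro: exI[of _ 0])
qed simp_all

text \<open>The layer of width \<open>1 / 2 ^ k\<close> at the boundary has area of order
  \<open>1 / 2 ^ k\<close> and the integrand there is taken of order \<open>2 powr (k * p)\<close>;
  the series is geometric with ratio \<open>2 powr (p - 1)\<close>.\<close>

lemma nn_integral_boundary_powr_finite:
  assumes "0 \<le> p" "p < 1"
  shows "(\<integral>\<^sup>+z\<in>unit_disc. ennreal ((1 - cmod z) powr - p) \<partial>lborel) < \<infinity>"
proof (rule nn_integral_layers_finite)
  let ?A = "\<lambda>k. ball (0::complex) 1 - ball 0 (1 - 1 / 2 ^ k)"
  show "emeasure lborel (?A k) \<le> ennreal (2 * pi * (1 / 2) ^ k)" for k
  proof -
    have "(1::real) - (1 - 1 / 2 ^ k)\<^sup>2 \<le> 2 * (1 / 2) ^ k"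
      by (simp add: power2_eq_square field_simps)
    from mult_left_mono[OF this, of pi] show ?thesis
      by (subst emeasure_lborel_annulus) (simp_all add: ennreal_leI mult.assoc mult.left_commute)
  qed
  have "(2 ^ Suc k) powr p * (2 * pi * (1 / 2) ^ k) = 2 powr p * 2 * pi * (2 powr (p - 1)) ^ k" for k :: nat
  proof -
    have "(2 ^ Suc k) powr p = 2 powr p * (2 powr p) ^ k"
      by (simp add: powr_mult powr_power powr_realpow[symmetric] powr_powr mult.commute)
    then show ?thesis
      by (simp add: powr_diff power_divide)
  qed
  moreover have "2 powr (p - 1) < (1::real)"
    using assms by (simp add: powr_less_one)
  ultimately show "summable (\<lambda>k. (2 ^ Suc k) powr p * (2 * pi * (1 / 2) ^ k))"
    by (simp only:) (intro summable_mult summable_geometric, simp)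
  fix z :: complex assume z: "z \<in> unit_disc"
  then obtain k where k: "1 / 2 ^ Suc k < 1 - cmod z" "1 - cmod z \<le> 1 / 2 ^ k"
    using exists_dyadic_scale[of "1 - cmod z"] by auto
  then have "inverse (1 - cmod z) \<le> 2 ^ Suc k"
    using z by (simp add: field_simps)
  then have "inverse (1 - cmod z) powr p \<le> (2 ^ Suc k) powr p"
    using z assms by (intro powr_mono2) auto
  moreover have "(1 - cmod z) powr - p = inverse (1 - cmod z) powr p"
    using z by (simp add: powr_minus inverse_powr)
  ultimately show "\<exists>k. z \<in> ?A k \<and> (1 - cmod z) powr - p \<le> (2 ^ Suc k) powr p"
    using k z by (intro exI[of _ k]) auto
qed simp_all

text \<open>From \<open>ln (1 / r) \<le> (1 - r) / r\<close> the logarithm cancels \<open>s\<close>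
  of the boundary exponent, leaving \<open>p - s < 1\<close>, at the price of a factor
  \<open>1 / r\<close>, which is integrable at the origin.\<close>

lemma nn_integral_radial_finite:
  assumes s: "0 < s" "s \<le> 1" and p: "s \<le> p" "p < 1 + s"
  shows "(\<integral>\<^sup>+z\<in>unit_disc. ennreal ((1 - cmod z) powr - p * ln (1 / cmod z) powr s) \<partial>lborel) < \<infinity>"
proof -
  have [measurable]: "unit_disc \<in> sets borel" by simp
  have "(\<integral>\<^sup>+z\<in>unit_disc. ennreal ((1 - cmod z) powr - p * ln (1 / cmod z) powr s) \<partial>lborel)
    \<le> (\<integral>\<^sup>+z. ennreal (2 powr (p - s)) * (ennreal (1 / cmod z) * indicator unit_disc z)
        + ennreal 2 * (ennreal ((1 - cmod z) powr - (p - s)) * indicator unit_disc z) \<partial>lborel)"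
  proof (rule nn_integral_mono)
    fix z :: complex
    define r where "r = cmod z"
    show "ennreal ((1 - cmod z) powr - p * ln (1 / cmod z) powr s) * indicator unit_disc z
      \<le> ennreal (2 powr (p - s)) * (ennreal (1 / cmod z) * indicator unit_disc z)
        + ennreal 2 * (ennreal ((1 - cmod z) powr - (p - s)) * indicator unit_disc z)"
    proof (cases "z \<noteq> 0 \<and> cmod z < 1")
      case True
      then have r: "0 < r" "r < 1" by (auto simp: r_def)
      have "ln (1 / r) \<le> (1 - r) * (1 / r)"
        using ln_le_minus_one[of "1 / r"] r by (simp add: field_simps del: ln_div)
      then have "ln (1 / r) powr s \<le> ((1 - r) * (1 / r)) powr s"
        using r s by (intro powr_mono2) auto
      also have "\<dots> = (1 - r) powr s * (1 / r) powr s"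
        using r by (subst powr_mult) auto
      also have "\<dots> \<le> (1 - r) powr s * (1 / r) powr 1"
        using r s by (intro mult_left_mono powr_mono) auto
      finally have "(1 - r) powr - p * ln (1 / r) powr s \<le> (1 - r) powr - p * ((1 - r) powr s * (1 / r))"
        using r by (intro mult_left_mono) auto
      also have "\<dots> = (1 - r) powr - (p - s) * (1 / r)"
        by (simp add: powr_add[symmetric] mult.assoc[symmetric])
      also have "\<dots> \<le> 2 powr (p - s) * (1 / r) + 2 * (1 - r) powr - (p - s)"
      \<comment> \<open>On each side of \<open>1 / 2\<close> one of the two singular factors is
        bounded.\<close>
      proof (cases "r \<le> 1 / 2")
        case True
        have "(1 - r) powr - (p - s) \<le> (1 / 2) powr - (p - s)"
          using True p by (intro powr_mono2') auto
        also have "\<dots> = 2 powr (p - s)"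
          by (simp add: powr_def ln_div algebra_simps)
        finally have "(1 - r) powr - (p - s) * (1 / r) \<le> 2 powr (p - s) * (1 / r)"
          using r by (intro mult_right_mono) auto
        then show ?thesis by (simp add: add_increasing2)
      next
        case False
        then have "1 / r \<le> 2" by (simp add: field_simps)
        then have "(1 - r) powr - (p - s) * (1 / r) \<le> (1 - r) powr - (p - s) * 2"
          by (intro mult_left_mono) auto
        then show ?thesis using r by (simp add: add_increasing)
      qed
      finally have "ennreal ((1 - r) powr - p * ln (1 / r) powr s)
          \<le> ennreal (2 powr (p - s) * (1 / r) + 2 * (1 - r) powr - (p - s))"
        by (rule ennreal_leI)
      also have "\<dots> = ennreal (2 powr (p - s)) * ennreal (1 / r) + ennreal 2 * ennreal ((1 - r) powr - (p - s))"
        using r by (subst ennreal_plus) (simp_all only: ennreal_mult' powr_ge_zero, simp_all)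
      finally show ?thesis
        using True by (simp add: r_def)
    qed auto
  qed
  also have "\<dots> = ennreal (2 powr (p - s)) * (\<integral>\<^sup>+z\<in>unit_disc. ennreal (1 / cmod z) \<partial>lborel)
        + ennreal 2 * (\<integral>\<^sup>+z\<in>unit_disc. ennreal ((1 - cmod z) powr - (p - s)) \<partial>lborel)"
    by (simp add: nn_integral_add nn_integral_cmult)
  also have "\<dots> < \<infinity>"
    using nn_integral_inverse_norm_finite nn_integral_boundary_powr_finite[of "p - s"] p
    by (simp add: ennreal_mult_less_top)
  finally show ?thesis .
qed

subsection \<open>A lacunary series\<close>

text \<open>Each of the \<open>n\<close> powers \<open>r ^ i\<close> with \<open>i < n\<close> is at
  least \<open>r ^ (n - 1)\<close>, and their sum times \<open>1 - r\<close> telescopes.\<close>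

lemma power_mult_one_minus_le:
  fixes r :: real
  assumes "0 \<le> r" "r \<le> 1"
  shows "real n * (1 - r) * r ^ (n - 1) \<le> 1"
proof (cases n)
  case (Suc j)
  have "real n * r ^ j = (\<Sum>i<n. r ^ j)" by simp
  also have "\<dots> \<le> (\<Sum>i<n. r ^ i)"
    using assms Suc by (intro sum_mono power_decreasing) auto
  finally have "(1 - r) * (real n * r ^ j) \<le> (1 - r) * (\<Sum>i<n. r ^ i)"
    using assms by (intro mult_left_mono) auto
  also have "\<dots> = 1 - r ^ n"
    by (rule one_diff_power_eq[symmetric])
  also have "\<dots> \<le> 1" using assms by simp
  finally show ?thesis using Suc by (simp add: mult_ac)
qed simp

text \<open>The preceding bound is raised to the power \<open>\<beta>\<close>; numbers in the unit
  interval only grow under this power. It serves to estimate the derivative of the lacunary series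
  term by term.\<close>

lemma power_le_boundary_powr:
  fixes r \<beta> :: real
  assumes r: "0 \<le> r" "r < 1" and \<beta>: "0 < \<beta>" "\<beta> \<le> 1" and n: "0 < n"
  shows "r ^ (n - 1) \<le> real n powr - \<beta> * (1 - r) powr - \<beta>"
proof -
  define x where "x = r ^ (n - 1)"
  have x: "0 \<le> x" "x \<le> 1" using r by (auto simp: x_def power_le_one)
  have "x \<le> x powr \<beta>"
    using powr_mono'[of \<beta> 1 x] x \<beta> by simp
  then have "(real n * (1 - r)) powr \<beta> * x \<le> (real n * (1 - r)) powr \<beta> * x powr \<beta>"
    by (intro mult_left_mono) auto
  also have "\<dots> = (real n * (1 - r) * x) powr \<beta>"
    using r x by (subst powr_mult) auto
  also have "\<dots> \<le> 1 powr \<beta>"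
    using power_mult_one_minus_le[of r n] r \<beta> x by (intro powr_mono2) (auto simp: x_def)
  finally have "real n powr \<beta> * (1 - r) powr \<beta> * x \<le> 1"
    using r by (simp add: powr_mult)
  then show ?thesis
    using r n unfolding x_def[symmetric] by (simp add: powr_minus field_simps)
qed

text \<open>In the annuli below the \<open>k\<close>-th term of the lacunary series dominates all other terms together.\<close>

lemma lacunary_lower_bound:
  fixes z S :: complex and Q :: real
  assumes Q: "100 \<le> Q" "Q \<le> 10000"
    and S: "(\<lambda>j. of_real (Q ^ j) * z ^ (10000 ^ j - 1)) sums S"
    and z: "1 - 3 / (4 * 10000 ^ k) \<le> cmod z" "cmod z \<le> 1 - 1 / (2 * 10000 ^ k)"
  shows "Q ^ k / 5 \<le> cmod S"
proof -
  define r where "r = cmod z"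
  \<comment> \<open>The extra factor \<open>z\<close> makes the exponents exact powers of 10000; as
    \<open>cmod z < 1\<close>, a lower bound for \<open>z * S\<close> is one for
    \<open>S\<close>.\<close>
  define t where "t j = of_real (Q ^ j) * z ^ (10000 ^ j)" for j
  have "(1::real) \<le> 10000 ^ k" by simp
  then have "3 < 4 * (10000::real) ^ k"
    by linarith
  then have "3 / (4 * 10000 ^ k) < (1::real)" "0 < 1 / (2 * 10000 ^ k :: real)"
    by simp_all
  then have r: "0 < r" "r < 1"
    using z unfolding r_def by linarith+
  have "(\<lambda>j. z * (of_real (Q ^ j) * z ^ (10000 ^ j - 1))) sums (z * S)"
    by (intro sums_mult S)
  moreover have "z * (of_real (Q ^ j) * z ^ (10000 ^ j - 1)) = t j" for j
    by (simp add: t_def power_eq_if[of z "10000 ^ j"] mult_ac)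
  ultimately have t: "t sums (z * S)" by simp
  have t_norm: "cmod (t j) = Q ^ j * r ^ (10000 ^ j)" for j
    using Q by (simp add: t_def r_def norm_mult norm_power)
  have main: "Q ^ k / 4 \<le> cmod (t k)"
  proof -
    \<comment> \<open>Bernoulli's inequality: with \<open>n = 10000 ^ k\<close>, the power
      \<open>(1 - 3 / (4 * n)) ^ n\<close> is at least \<open>1 / 4\<close>.\<close>
    have "1 + real (10000 ^ k) * (- (3 / (4 * 10000 ^ k))) \<le> (1 + - (3 / (4 * 10000 ^ k))) ^ (10000 ^ k)"
      using \<open>3 / (4 * 10000 ^ k) < 1\<close> by (intro Bernoulli_inequality) linarith
    also have "\<dots> \<le> r ^ (10000 ^ k)"
      using z \<open>3 / (4 * 10000 ^ k) < 1\<close> by (intro power_mono) (auto simp: r_def)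
    finally have "1 / 4 \<le> r ^ (10000 ^ k)" by simp
    then have "Q ^ k * (1 / 4) \<le> Q ^ k * r ^ (10000 ^ k)"
      using Q by (intro mult_left_mono) auto
    then show ?thesis by (simp add: t_norm)
  qed
  have initial: "(\<Sum>j<k. cmod (t j)) \<le> Q ^ k / 99"
  proof -
    have "(\<Sum>j<k. cmod (t j)) \<le> (\<Sum>j<k. Q ^ j)"
      using Q r by (intro sum_mono) (simp add: t_norm mult_left_le power_le_one)
    also have "\<dots> = (Q ^ k - 1) / (Q - 1)"
      using Q by (intro geometric_sum) auto
    also have "\<dots> \<le> Q ^ k / 99"
      using Q by (intro frac_le) auto
    finally show ?thesis .
  qed
  \<comment> \<open>Past index \<open>k\<close>, with \<open>i = Suc j\<close>, the power of
    \<open>r\<close> is at most \<open>exp (- x)\<close> with \<open>x = 10000 ^ i / 2\<close>,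
    hence at most \<open>8 / 10000 ^ (2 * i)\<close>. This beats the growth
    \<open>Q ^ i \<le> 10000 ^ i\<close>.\<close>
  have term_bound: "cmod (t (j + Suc k)) \<le> 8 * Q ^ k / 10000 * (1 / 10000) ^ j" for j
  proof -
    define i where "i = Suc j"
    define x :: real where "x = 10000 ^ i / 2"
    have x: "0 \<le> x" by (simp add: x_def)
    have "r ^ (10000 ^ (i + k)) \<le> exp (- (1 / (2 * 10000 ^ k))) ^ (10000 ^ (i + k))"
    proof (rule power_mono)
      show "r \<le> exp (- (1 / (2 * 10000 ^ k)))"
        using z(2) exp_ge_add_one_self[of "- (1 / (2 * 10000 ^ k))"] by (simp add: r_def)
    qed (use r in simp)
    also have "\<dots> = exp (- x)"
      by (simp add: exp_of_nat_mult[symmetric] x_def power_add)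
    also have "\<dots> \<le> 1 / (x\<^sup>2 / 2)"
    proof -
      have "x\<^sup>2 / 2 \<le> exp x"
        using exp_lower_Taylor_quadratic[of x] x by linarith
      then show ?thesis by (simp add: exp_minus x_def field_simps)
    qed
    finally have "r ^ (10000 ^ (i + k)) \<le> 8 / (10000 ^ i)\<^sup>2"
      by (simp add: x_def power_divide)
    then have "cmod (t (i + k)) \<le> Q ^ (i + k) * (8 / (10000 ^ i)\<^sup>2)"
      using Q unfolding t_norm by (intro mult_left_mono) auto
    also have "\<dots> = Q ^ i * (Q ^ k * (8 / (10000 ^ i)\<^sup>2))"
      by (simp add: power_add)
    also have "\<dots> \<le> 10000 ^ i * (Q ^ k * (8 / (10000 ^ i)\<^sup>2))"
      using Q by (intro mult_right_mono power_mono) auto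
    also have "\<dots> = 8 * Q ^ k / 10000 * (1 / 10000) ^ j"
      by (simp add: i_def power2_eq_square field_simps)
    finally show ?thesis by (simp add: i_def)
  qed
  have geo: "(\<lambda>j. 8 * Q ^ k / 10000 * (1 / 10000) ^ j) sums (8 * Q ^ k / 10000 * (1 / (1 - 1 / 10000)))"
    by (intro sums_mult geometric_sums) simp
  have tail: "cmod (\<Sum>j. t (j + Suc k)) \<le> 8 * Q ^ k / 9999"
  proof -
    have "cmod (\<Sum>j. t (j + Suc k)) \<le> (\<Sum>j. 8 * Q ^ k / 10000 * (1 / 10000) ^ j)"
      by (rule norm_suminf_le[OF term_bound sums_summable[OF geo]])
    also have "\<dots> = 8 * Q ^ k / 9999"
      unfolding sums_unique[OF geo, symmetric] by simp
    finally show ?thesis .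
  qed
  have "z * S = (\<Sum>j. t (j + Suc k)) + (\<Sum>j<Suc k. t j)"
    using suminf_split_initial_segment[OF sums_summable[OF t], of "Suc k"] sums_unique[OF t] by simp
  then have "t k = z * S - (\<Sum>j. t (j + Suc k)) - (\<Sum>j<k. t j)"
    by simp
  then have "cmod (t k) \<le> cmod (z * S) + cmod (\<Sum>j. t (j + Suc k)) + cmod (\<Sum>j<k. t j)"
    using norm_triangle_ineq4[of "z * S - (\<Sum>j. t (j + Suc k))" "\<Sum>j<k. t j"]
      norm_triangle_ineq4[of "z * S" "\<Sum>j. t (j + Suc k)"] by simp
  also have "cmod (\<Sum>j<k. t j) \<le> (\<Sum>j<k. cmod (t j))" by (rule norm_sum)
  finally have "Q ^ k / 4 \<le> cmod (z * S) + 8 * Q ^ k / 9999 + Q ^ k / 99"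
    using main initial tail by linarith
  moreover have "0 \<le> Q ^ k" using Q by simp
  \<comment> \<open>The numerical margin is \<open>1/4 - 8/9999 - 1/99 > 1/5\<close>.\<close>
  ultimately have "Q ^ k / 5 \<le> cmod (z * S)" by linarith
  also have "\<dots> \<le> cmod S"
    using r by (simp add: norm_mult r_def mult_left_le_one_le)
  finally show ?thesis .
qed

text \<open>The function is the sum of \<open>n powr (\<alpha> - 1) * z ^ n\<close> over
  \<open>n = 10000 ^ j\<close>. It is bounded as \<open>\<alpha> < 1\<close>. The terms of its
  derivative are at most \<open>n powr (\<alpha> - \<beta>) * (1 - cmod z) powr - \<beta>\<close>,
  which is summable as \<open>\<alpha> < \<beta>\<close>. The range of the exponents puts
  \<open>Q\<close> between 100 and 10000, as the lower bound demands.\<close>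

lemma exists_lacunary_function:
  fixes \<alpha> \<beta> :: real
  assumes "1 / 2 \<le> \<alpha>" "\<alpha> < \<beta>" "\<beta> \<le> 1"
  obtains f :: "complex \<Rightarrow> complex" and C :: real where
    "f holomorphic_on unit_disc"
    "\<And>z. z \<in> unit_disc \<Longrightarrow> cmod (f z) \<le> C"
    "\<And>z. z \<in> unit_disc \<Longrightarrow> cmod (deriv f z) \<le> C * (1 - cmod z) powr - \<beta>"
    "\<And>k z. \<lbrakk>1 - 3 / (4 * 10000 ^ k) \<le> cmod z; cmod z \<le> 1 - 1 / (2 * 10000 ^ k)\<rbrakk>
      \<Longrightarrow> (10000 ^ k) powr \<alpha> / 5 \<le> cmod (deriv f z)"
proof -
  define Q B :: real where "Q = 10000 powr \<alpha>" and "B = 10000 powr \<beta>"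
  have "(10000::real) powr (1 / 2) = 100"
    by (simp add: powr_half_sqrt real_sqrt_unique)
  then have Q: "100 \<le> Q" "Q < B" "B \<le> 10000"
    using assms powr_mono[of "1/2" \<alpha> 10000] powr_mono[of \<beta> 1 10000] by (simp_all add: Q_def B_def)
  define u where "u j z = of_real ((Q / 10000) ^ j) * z ^ (10000 ^ j)" for j and z :: complex
  define u' where "u' j z = of_real (Q ^ j) * z ^ (10000 ^ j - 1)" for j and z :: complex
  have u_le: "cmod (u j z) \<le> (Q / 10000) ^ j" if "z \<in> unit_disc" for j z
    using that Q by (simp add: u_def norm_mult norm_power mult_left_le power_le_one)
  have deriv_u: "(u j has_field_derivative u' j z) (at z)" for j z
    unfolding u_def u'_def
    by (auto intro!: derivative_eq_intros simp: power_divide)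
  have sumQ: "summable (\<lambda>j. (Q / 10000) ^ j)"
    using Q by (intro summable_geometric) auto
  have "\<forall>\<^sub>F j in sequentially. \<forall>z\<in>unit_disc. cmod (u j z) \<le> (Q / 10000) ^ j"
    using u_le by simp
  from series_and_derivative_comparison[OF open_ball sumQ deriv_u this]
  obtain f f' where f: "\<forall>z\<in>unit_disc. (\<lambda>j. u j z) sums f z \<and> (\<lambda>j. u' j z) sums f' z \<and> (f has_field_derivative f' z) (at z)" .
  have df: "deriv f z = f' z" if "z \<in> unit_disc" for z
    using f that by (auto intro: DERIV_imp_deriv)
  have geoQ: "(\<lambda>j. (Q / 10000) ^ j) sums (1 / (1 - Q / 10000))"
    and geoB: "(\<lambda>j. (Q / B) ^ j) sums (1 / (1 - Q / B))"
    using Q by (auto intro!: geometric_sums)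
  define C where "C = max (1 / (1 - Q / 10000)) (1 / (1 - Q / B))"
  show thesis
  proof
    show "f holomorphic_on unit_disc"
      using f by (auto simp: holomorphic_on_def field_differentiable_def intro: has_field_derivative_at_within)
    show "cmod (f z) \<le> C" if z: "z \<in> unit_disc" for z
    proof -
      have "cmod (\<Sum>j. u j z) \<le> (\<Sum>j. (Q / 10000) ^ j)"
        by (rule norm_suminf_le[OF u_le[OF z] sumQ])
      then show ?thesis
        using f z sums_unique[OF geoQ] by (auto simp: C_def sums_iff)
    qed
    show "cmod (deriv f z) \<le> C * (1 - cmod z) powr - \<beta>" if z: "z \<in> unit_disc" for z
    proof -
      have "cmod (u' j z) \<le> (Q / B) ^ j * (1 - cmod z) powr - \<beta>" for j
      proof -
        have "cmod z ^ (10000 ^ j - 1) \<le> real (10000 ^ j) powr - \<beta> * (1 - cmod z) powr - \<beta>"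
          using z assms by (intro power_le_boundary_powr) auto
        also have "real (10000 ^ j) powr - \<beta> = 1 / B ^ j"
          by (simp add: B_def powr_minus powr_power powr_realpow[symmetric] powr_powr mult.commute field_simps)
        finally have "Q ^ j * cmod z ^ (10000 ^ j - 1) \<le> Q ^ j * (1 / B ^ j * (1 - cmod z) powr - \<beta>)"
          using Q by (intro mult_left_mono) auto
        then show ?thesis
          using Q by (simp add: u'_def norm_mult norm_power power_divide)
      qed
      then have "cmod (\<Sum>j. u' j z) \<le> (\<Sum>j. (Q / B) ^ j * (1 - cmod z) powr - \<beta>)"
        by (rule norm_suminf_le) (intro summable_mult2 sums_summable[OF geoB])
      also have "\<dots> = 1 / (1 - Q / B) * (1 - cmod z) powr - \<beta>"
        by (rule sums_unique[symmetric], intro sums_mult2 geoB)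
      also have "\<dots> \<le> C * (1 - cmod z) powr - \<beta>"
        by (intro mult_right_mono) (auto simp: C_def)
      finally show ?thesis
        using f z df by (auto simp: sums_iff)
    qed
    show "(10000 ^ k) powr \<alpha> / 5 \<le> cmod (deriv f z)"
      if z: "1 - 3 / (4 * 10000 ^ k) \<le> cmod z" "cmod z \<le> 1 - 1 / (2 * 10000 ^ k)" for k z
    proof -
      have "0 < 1 / (2 * 10000 ^ k :: real)" by simp
      then have "cmod z < 1" using z(2) by linarith
      then have zd: "z \<in> unit_disc" by simp
      have "(10000 ^ k) powr \<alpha> = Q ^ k"
        by (simp add: Q_def powr_power powr_realpow[symmetric] powr_powr mult.commute)
      moreover have "Q ^ k / 5 \<le> cmod (f' z)"
        using f zd Q z by (intro lacunary_lower_bound[where z = z and k = k]) (auto simp: u'_def)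
      ultimately show ?thesis using df zd by simp
    qed
  qed
qed

subsection \<open>Lower bounds on annuli\<close>

lemma measurable_continuous_times_indicator:
  fixes f :: "'a::topological_space \<Rightarrow> real"
  assumes "S \<in> sets borel" "continuous_on S f"
  shows "(\<lambda>x. ennreal (f x) * indicator S x) \<in> borel_measurable borel"
proof -
  have [measurable]: "(\<lambda>x. indicator S x *\<^sub>R f x) \<in> borel_measurable borel"
    using assms by (rule borel_measurable_continuous_on_indicator)
  have eq: "(\<lambda>x. ennreal (f x) * indicator S x) = (\<lambda>x. ennreal (indicator S x *\<^sub>R f x))"
    by (auto simp: indicator_def)
  show ?thesis unfolding eq by measurable
qed

text \<open>The \<open>k\<close>-th Fourier coefficient of \<open>g\<close> on the circle through
  \<open>z\<close> is the Taylor coefficient times \<open>z ^ k\<close>; it is bounded by the mean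
  of the modulus, and this by the quadratic mean.\<close>

lemma circle_mean_square_ge:
  assumes g: "g holomorphic_on unit_disc" and z: "z \<noteq> 0" "cmod z < 1"
  shows "ennreal ((cmod ((deriv ^^ k) g 0 / fact k) * cmod z ^ k)\<^sup>2)
    \<le> (\<integral>\<^sup>+t\<in>{0..1}. ennreal ((cmod (g (z * cis (2 * pi * t))))\<^sup>2) \<partial>lborel)"
proof -
  define f where "f u = g (z * u)" for u
  define R where "R = 1 / cmod z"
  have R: "1 < R" using z by (simp add: R_def)
  have zu: "z * u \<in> unit_disc" if "u \<in> ball 0 R" for u
    using that z by (simp add: R_def norm_mult field_simps)
  have f: "f holomorphic_on ball 0 R"
    unfolding f_def using zu
    by (intro holomorphic_on_compose_gen[OF _ g, unfolded o_def] holomorphic_intros) auto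
  define c where "c = (deriv ^^ k) f 0 / fact k"
  have "(deriv ^^ k) f 0 = z ^ k * (deriv ^^ k) g (z * 0)"
    unfolding f_def using R by (intro higher_deriv_compose_linear[OF g, of "ball 0 R"] zu) simp_all
  then have c: "cmod c = cmod ((deriv ^^ k) g 0 / fact k) * cmod z ^ k"
    by (simp add: c_def norm_mult norm_divide norm_power)
  define p where "p t = cmod (f (cis (2 * pi * t)))" for t :: real
  have "continuous_on {0..1} (\<lambda>t. f (cis (2 * pi * t)))"
  proof (rule continuous_on_compose2[OF holomorphic_on_imp_continuous_on[OF f]])
    show "continuous_on {0..1} (\<lambda>t. cis (2 * pi * t))" by (intro continuous_intros)
  qed (use R in auto)
  then have cont: "continuous_on {0..1} p"
    unfolding p_def by (rule continuous_on_norm)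
  have int: "((\<lambda>t. f (cis (2 * pi * t)) * cis (- (2 * pi * real k * t))) has_integral c) {0..1}"
    unfolding c_def by (rule has_integral_circle_coefficient[OF f R])
  have int_p: "p integrable_on {0..1}" "(\<lambda>t. (p t)\<^sup>2) integrable_on {0..1}"
    by (intro integrable_continuous_real continuous_intros cont)+
  have "cmod c = cmod (integral {0..1} (\<lambda>t. f (cis (2 * pi * t)) * cis (- (2 * pi * real k * t))))"
    using int by (simp add: integral_unique)
  also have "\<dots> \<le> integral {0..1} p"
    using int int_p by (intro Henstock_Kurzweil_Integration.integral_norm_bound_integral) (auto simp: p_def norm_mult)
  finally have cp: "cmod c \<le> integral {0..1} p" .
  \<comment> \<open>Cauchy-Schwarz by hand: integrate
    \<open>(p t - cmod c)^2 \<ge> 0\<close>.\<close>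
  have "((\<lambda>t. 2 * cmod c * p t - (cmod c)\<^sup>2) has_integral 2 * cmod c * integral {0..1} p - (cmod c)\<^sup>2) {0..1}"
    using has_integral_const_real[of "(cmod c)\<^sup>2" 0 1]
    by (intro has_integral_diff has_integral_mult_right integrable_integral int_p) simp_all
  then have "2 * cmod c * integral {0..1} p - (cmod c)\<^sup>2 \<le> integral {0..1} (\<lambda>t. (p t)\<^sup>2)"
  proof (rule has_integral_le[OF _ integrable_integral[OF int_p(2)]])
    show "2 * cmod c * p t - (cmod c)\<^sup>2 \<le> (p t)\<^sup>2" for t
      using zero_le_power2[of "p t - cmod c"] by (simp add: power2_diff mult_ac)
  qed
  moreover have "cmod c * cmod c \<le> cmod c * integral {0..1} p"
    using cp by (rule mult_left_mono) simp
  ultimately have "(cmod c)\<^sup>2 \<le> integral {0..1} (\<lambda>t. (p t)\<^sup>2)"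
    by (simp add: power2_eq_square)
  moreover have "(\<integral>\<^sup>+t\<in>{0..1}. ennreal ((p t)\<^sup>2) \<partial>lborel) = ennreal (integral {0..1} (\<lambda>t. (p t)\<^sup>2))"
    by (intro nn_integral_has_integral_lebesgue' integrable_integral int_p) simp
  ultimately show ?thesis
    by (simp add: c p_def f_def ennreal_leI)
qed

text \<open>The annulus is invariant under rotation, so averaging over circles keeps its indicator,
  and the bound on circular means can be integrated with \<open>r \<le> cmod z\<close>.\<close>

lemma annulus_square_integral_ge:
  assumes g: "g holomorphic_on unit_disc" and r: "0 < r" "r \<le> R" "R \<le> 1"
  shows "ennreal ((cmod ((deriv ^^ k) g 0 / fact k) * r ^ k)\<^sup>2 * (pi * (R\<^sup>2 - r\<^sup>2)))
    \<le> (\<integral>\<^sup>+z\<in>ball 0 R - ball 0 r. ennreal ((cmod (g z))\<^sup>2) \<partial>lborel)"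
proof -
  let ?A = "ball 0 R - ball 0 r :: complex set"
  let ?c = "cmod ((deriv ^^ k) g 0 / fact k)"
  have "continuous_on ?A g"
    using r by (intro holomorphic_on_imp_continuous_on holomorphic_on_subset[OF g]) auto
  then have meas: "(\<lambda>z. ennreal ((cmod (g z))\<^sup>2) * indicator ?A z) \<in> borel_measurable borel"
    by (intro measurable_continuous_times_indicator continuous_intros) auto
  have "ennreal ((?c * r ^ k)\<^sup>2 * (pi * (R\<^sup>2 - r\<^sup>2))) = (\<integral>\<^sup>+z\<in>?A. ennreal ((?c * r ^ k)\<^sup>2) \<partial>lborel)"
    using r by (simp add: nn_integral_cmult_indicator emeasure_lborel_annulus ennreal_mult')
  also have "\<dots> \<le> (\<integral>\<^sup>+z. (\<integral>\<^sup>+t\<in>{0..1}. ennreal ((cmod (g (z * cis (2 * pi * t))))\<^sup>2) * indicator ?A (z * cis (2 * pi * t)) \<partial>lborel) \<partial>lborel)"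
  proof (rule nn_integral_mono)
    fix z :: complex
    show "ennreal ((?c * r ^ k)\<^sup>2) * indicator ?A z
      \<le> (\<integral>\<^sup>+t\<in>{0..1}. ennreal ((cmod (g (z * cis (2 * pi * t))))\<^sup>2) * indicator ?A (z * cis (2 * pi * t)) \<partial>lborel)"
    proof (cases "z \<in> ?A")
      case True
      then have z: "r \<le> cmod z" "z \<noteq> 0" "cmod z < 1" using r by auto
      have "(?c * r ^ k)\<^sup>2 \<le> (?c * cmod z ^ k)\<^sup>2"
        using z r by (intro power_mono mult_left_mono) auto
      then have "ennreal ((?c * r ^ k)\<^sup>2) \<le> ennreal ((?c * cmod z ^ k)\<^sup>2)"
        by (rule ennreal_leI)
      also have "\<dots> \<le> (\<integral>\<^sup>+t\<in>{0..1}. ennreal ((cmod (g (z * cis (2 * pi * t))))\<^sup>2) \<partial>lborel)"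
        by (rule circle_mean_square_ge[OF g z(2,3)])
      finally show ?thesis using True by (simp add: norm_mult)
    qed simp
  qed
  also have "\<dots> = (\<integral>\<^sup>+z\<in>?A. ennreal ((cmod (g z))\<^sup>2) \<partial>lborel)"
    by (rule nn_integral_circle_average[OF meas, symmetric])
  finally show ?thesis .
qed

text \<open>On the annulus with \<open>n = 10000 ^ k\<close> the square of \<open>h\<close> is of
  order at least \<open>n powr (2 * \<alpha>)\<close>, the weight at least
  \<open>n powr - s\<close>, and the integral of the square of \<open>g\<close> at least
  \<open>1 / n\<close>. Their product is unbounded in \<open>k\<close>, so single annuli refute
  every finite bound \<open>X\<close>.\<close>

lemma weighted_square_integral_infinite:
  fixes g h :: "complex \<Rightarrow> complex"
  assumes g: "g holomorphic_on unit_disc" "w \<in> unit_disc" "g w \<noteq> 0"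
    and \<alpha>: "1 + s < 2 * \<alpha>" and s: "0 \<le> s"
    and h: "\<And>k z. \<lbrakk>1 - 3 / (4 * 10000 ^ k) \<le> cmod z; cmod z \<le> 1 - 1 / (2 * 10000 ^ k)\<rbrakk>
      \<Longrightarrow> (10000 ^ k) powr \<alpha> / 5 \<le> cmod (h z)"
  shows "(\<integral>\<^sup>+z\<in>unit_disc. ennreal ((cmod (g z * h z))\<^sup>2 * (1 - cmod z) powr s) \<partial>lborel) = \<infinity>"
proof (rule ccontr)
  assume "\<not> ?thesis"
  then obtain X where X: "0 \<le> X"
    "(\<integral>\<^sup>+z\<in>unit_disc. ennreal ((cmod (g z * h z))\<^sup>2 * (1 - cmod z) powr s) \<partial>lborel) = ennreal X"
    by (cases "\<integral>\<^sup>+z\<in>unit_disc. ennreal ((cmod (g z * h z))\<^sup>2 * (1 - cmod z) powr s) \<partial>lborel") auto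
  obtain m where m: "(deriv ^^ m) g 0 \<noteq> 0"
    using holomorphic_fun_eq_0_on_ball[OF g(1,2)] g(3) by blast
  define c where "c = cmod ((deriv ^^ m) g 0 / fact m)"
  have c: "0 < c" using m by (simp add: c_def)
  \<comment> \<open>The constants, in order: from \<open>h\<close>, from the weight, from the Taylor
    coefficient with \<open>r \<ge> 1 / 4\<close>, and from the area, which is at least
    \<open>pi / (8 * n)\<close>.\<close>
  define D where "D = (1 / 25) * (1 / 2) powr s * ((c * (1 / 4) ^ m)\<^sup>2 * (pi / 8))"
  have D: "0 < D" using c by (simp add: D_def)
  define e where "e = 2 * \<alpha> - s - 1"
  have bound: "D * (10000 powr e) ^ k \<le> X" for k
  proof -
    define n :: real where "n = 10000 ^ k"
    define r R where "r = 1 - 3 / (4 * n)" and "R = 1 - 1 / (2 * n)"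
    let ?A = "ball 0 R - ball 0 r :: complex set"
    have n: "1 \<le> n" by (simp add: n_def)
    have r: "1 / 4 \<le> r" "r \<le> R" "R \<le> 1" "1 / 2 \<le> R"
      using n by (simp_all add: r_def R_def field_simps)
    have "R - r = 1 / (4 * n)" using n by (simp add: r_def R_def field_simps)
    then have "R\<^sup>2 - r\<^sup>2 = (R + r) * (1 / (4 * n))"
      by (simp add: power2_eq_square algebra_simps flip: \<open>R - r = 1 / (4 * n)\<close>)
    also have "\<dots> \<ge> 1 / 2 * (1 / (4 * n))"
      using r n by (intro mult_right_mono) auto
    finally have area: "1 / (8 * n) \<le> R\<^sup>2 - r\<^sup>2" by simp
    define K where "K = (n powr \<alpha> / 5)\<^sup>2 * (1 / (2 * n)) powr s"
    have "K * ((c * (1 / 4) ^ m)\<^sup>2 * (pi * (1 / (8 * n)))) \<le> K * ((c * r ^ m)\<^sup>2 * (pi * (R\<^sup>2 - r\<^sup>2)))"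
      using r c area n by (intro mult_left_mono mult_mono power_mono) (auto simp: K_def)
    then have "ennreal (K * ((c * (1 / 4) ^ m)\<^sup>2 * (pi * (1 / (8 * n))))) \<le> ennreal (K * ((c * r ^ m)\<^sup>2 * (pi * (R\<^sup>2 - r\<^sup>2))))"
      by (rule ennreal_leI)
    also have "\<dots> = ennreal K * ennreal ((c * r ^ m)\<^sup>2 * (pi * (R\<^sup>2 - r\<^sup>2)))"
      by (rule ennreal_mult') (simp add: K_def)
    also have "\<dots> \<le> ennreal K * (\<integral>\<^sup>+z\<in>?A. ennreal ((cmod (g z))\<^sup>2) \<partial>lborel)"
      using r unfolding c_def by (intro mult_left_mono annulus_square_integral_ge g) auto
    also have "\<dots> = (\<integral>\<^sup>+z. ennreal K * (ennreal ((cmod (g z))\<^sup>2) * indicator ?A z) \<partial>lborel)"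
    proof (rule nn_integral_cmult[symmetric])
      have "continuous_on ?A g"
        using r by (intro holomorphic_on_imp_continuous_on holomorphic_on_subset[OF g(1)]) auto
      then show "(\<lambda>z. ennreal ((cmod (g z))\<^sup>2) * indicator ?A z) \<in> borel_measurable lborel"
        by (simp, intro measurable_continuous_times_indicator continuous_intros) auto
    qed
    also have "\<dots> \<le> (\<integral>\<^sup>+z\<in>unit_disc. ennreal ((cmod (g z * h z))\<^sup>2 * (1 - cmod z) powr s) \<partial>lborel)"
    proof (rule nn_integral_mono)
      fix z :: complex
      show "ennreal K * (ennreal ((cmod (g z))\<^sup>2) * indicator ?A z)
        \<le> ennreal ((cmod (g z * h z))\<^sup>2 * (1 - cmod z) powr s) * indicator unit_disc z"
      proof (cases "z \<in> ?A")
        case True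
        then have z: "r \<le> cmod z" "cmod z < R" by auto
        have "n powr \<alpha> / 5 \<le> cmod (h z)"
          using h[of k z] z by (simp add: n_def r_def R_def)
        moreover have "1 / (2 * n) \<le> 1 - cmod z"
          using z by (simp add: R_def)
        ultimately have "K \<le> (cmod (h z))\<^sup>2 * (1 - cmod z) powr s"
          unfolding K_def using n s by (intro mult_mono power_mono powr_mono2) auto
        then have "K * (cmod (g z))\<^sup>2 \<le> (cmod (h z))\<^sup>2 * (1 - cmod z) powr s * (cmod (g z))\<^sup>2"
          by (rule mult_right_mono) simp
        also have "\<dots> = (cmod (g z * h z))\<^sup>2 * (1 - cmod z) powr s"
          by (simp add: norm_mult power_mult_distrib mult_ac)
        finally have "ennreal K * ennreal ((cmod (g z))\<^sup>2) \<le> ennreal ((cmod (g z * h z))\<^sup>2 * (1 - cmod z) powr s)"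
          by (simp add: ennreal_leI flip: ennreal_mult'')
        then show ?thesis
          using True r by simp
      qed simp
    qed
    also have "\<dots> = ennreal X" by (rule X)
    finally have "K * ((c * (1 / 4) ^ m)\<^sup>2 * (pi * (1 / (8 * n)))) \<le> X"
      using X(1) by simp
    moreover have "K * ((c * (1 / 4) ^ m)\<^sup>2 * (pi * (1 / (8 * n)))) = D * (10000 powr e) ^ k"
    proof -
      have "(10000 powr e) ^ k = n powr e"
        by (simp add: n_def powr_power powr_realpow[symmetric] powr_powr mult.commute)
      also have "\<dots> = (n powr \<alpha>)\<^sup>2 / n powr s / n"
        using n by (simp add: e_def powr_diff power2_eq_square flip: powr_add)
      moreover have "(1 / (2 * n)) powr s = (1 / 2) powr s / n powr s"
        using n by (simp add: powr_divide powr_mult)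
      ultimately show ?thesis
        by (simp add: K_def D_def power_divide mult_ac)
    qed
    ultimately show ?thesis by simp
  qed
  have "1 < 10000 powr e"
    using \<alpha> by (simp add: e_def)
  then obtain k where "X / D < (10000 powr e) ^ k"
    using real_arch_pow by blast
  then show False
    using bound[of k] D by (simp add: field_simps)
qed

subsection \<open>Membership in the spaces\<close>

lemma nn_integral_disc_area:
  assumes "(\<lambda>z. F z * indicator unit_disc z) \<in> borel_measurable borel"
  shows "(\<integral>\<^sup>+z. F z \<partial>disc_area) = ennreal (1 / pi) * (\<integral>\<^sup>+z\<in>unit_disc. F z \<partial>lborel)"
proof -
  have "F \<in> borel_measurable (restrict_space lborel unit_disc)"
    using assms by (simp add: borel_measurable_restrict_space_iff_ennreal)
  then show ?thesis
    by (simp add: disc_area_def nn_integral_scale_measure nn_integral_restrict_space)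
qed

lemma continuous_on_deriv_square:
  assumes "f holomorphic_on unit_disc"
  shows "continuous_on unit_disc (\<lambda>z. (cmod (deriv f z))\<^sup>2)"
  using holomorphic_on_imp_continuous_on[OF holomorphic_deriv[OF assms open_ball]]
  by (intro continuous_intros)

text \<open>Outside the disc \<open>deriv f\<close> is arbitrary, hence the indicator.\<close>

lemma measurable_deriv_square_times_green:
  assumes "f holomorphic_on unit_disc"
  shows "(\<lambda>z. ennreal ((cmod (deriv f z))\<^sup>2 * green z a powr s) * indicator unit_disc z) \<in> borel_measurable borel"
proof -
  have [measurable]: "(\<lambda>z. ennreal ((cmod (deriv f z))\<^sup>2) * indicator unit_disc z) \<in> borel_measurable borel"
    using continuous_on_deriv_square[OF assms] by (intro measurable_continuous_times_indicator) auto
  have "ennreal ((cmod (deriv f z))\<^sup>2 * green z a powr s) * indicator unit_disc z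
      = ennreal ((cmod (deriv f z))\<^sup>2) * indicator unit_disc z * ennreal (green z a powr s)" for z
    by (simp add: ennreal_mult mult_ac)
  then show ?thesis by simp
qed

text \<open>The bound replaces the square of the derivative by a radial weight \<open>W\<close>. Its
  potential is at most \<open>L\<close>, the value at the origin, uniformly in \<open>a\<close>, and
  \<open>L\<close> is finite by the radial estimate with \<open>p = 2 * \<beta>\<close>.\<close>

lemma Q_space_if_deriv_le:
  assumes f: "f holomorphic_on unit_disc" and s: "0 < s" "s \<le> 1"
    and \<beta>: "s \<le> 2 * \<beta>" "2 * \<beta> < 1 + s"
    and le: "\<And>z. z \<in> unit_disc \<Longrightarrow> cmod (deriv f z) \<le> C * (1 - cmod z) powr - \<beta>"
  shows "f \<in> Q_space s"
proof -
  define W where "W r = C\<^sup>2 * (1 - r) powr - (2 * \<beta>)" for r :: real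
  have [measurable]: "W \<in> borel_measurable borel" "unit_disc \<in> sets borel"
    unfolding W_def by measurable
  define L where "L = (\<integral>\<^sup>+z\<in>unit_disc. ennreal (W (cmod z) * ln (1 / cmod z) powr s) \<partial>lborel)"
  have "L = (\<integral>\<^sup>+z. ennreal (C\<^sup>2) * (ennreal ((1 - cmod z) powr - (2 * \<beta>) * ln (1 / cmod z) powr s) * indicator unit_disc z) \<partial>lborel)"
    unfolding L_def W_def by (intro nn_integral_cong) (simp add: mult.assoc ennreal_mult)
  also have "\<dots> = ennreal (C\<^sup>2) * (\<integral>\<^sup>+z\<in>unit_disc. ennreal ((1 - cmod z) powr - (2 * \<beta>) * ln (1 / cmod z) powr s) \<partial>lborel)"
    by (rule nn_integral_cmult) measurable
  also have "\<dots> < \<infinity>"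
    using nn_integral_radial_finite[OF s \<beta>] by (simp add: ennreal_mult_less_top)
  finally have L: "L < \<infinity>" .
  have "(\<integral>\<^sup>+z. ennreal ((cmod (deriv f z))\<^sup>2 * green z a powr s) \<partial>disc_area) \<le> ennreal (1 / pi) * L"
    if a: "a \<in> unit_disc" for a
  proof -
    have "(\<integral>\<^sup>+z\<in>unit_disc. ennreal ((cmod (deriv f z))\<^sup>2 * green z a powr s) \<partial>lborel)
        \<le> (\<integral>\<^sup>+z\<in>unit_disc. ennreal (W (cmod z) * green z a powr s) \<partial>lborel)"
    proof (rule nn_integral_mono)
      fix z :: complex
      show "ennreal ((cmod (deriv f z))\<^sup>2 * green z a powr s) * indicator unit_disc z
          \<le> ennreal (W (cmod z) * green z a powr s) * indicator unit_disc z"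
      proof (cases "z \<in> unit_disc")
        case True
        have "(cmod (deriv f z))\<^sup>2 \<le> (C * (1 - cmod z) powr - \<beta>)\<^sup>2"
          using le[OF True] by (rule power_mono) simp
        also have "\<dots> = W (cmod z)"
          by (simp add: W_def power_mult_distrib power2_eq_square flip: powr_add)
        finally show ?thesis
          using True by (simp add: ennreal_leI mult_right_mono)
      qed simp
    qed
    also have "\<dots> \<le> L"
      unfolding L_def using a s by (intro green_powr_potential_le) (auto simp: W_def)
    finally show ?thesis
      unfolding nn_integral_disc_area[OF measurable_deriv_square_times_green[OF f]]
      by (rule mult_left_mono) simp
  qed
  then have "(SUP a\<in>unit_disc. \<integral>\<^sup>+z. ennreal ((cmod (deriv f z))\<^sup>2 * green z a powr s) \<partial>disc_area)
      \<le> ennreal (1 / pi) * L"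
    by (rule SUP_least)
  also have "\<dots> < \<infinity>"
    using L by (simp add: ennreal_mult_less_top)
  finally show ?thesis
    using f by (simp add: Q_space_def)
qed

text \<open>Only \<open>a = 0\<close> is taken from the supremum, where the Green function is
  \<open>ln (1 / cmod z) \<ge> 1 - cmod z\<close>.\<close>

lemma Q_space_imp_dirichlet_finite:
  assumes f: "f \<in> Q_space s" and s: "0 < s"
  shows "(\<integral>\<^sup>+z\<in>unit_disc. ennreal ((cmod (deriv f z))\<^sup>2 * (1 - cmod z) powr s) \<partial>lborel) < \<infinity>"
proof -
  have hol: "f holomorphic_on unit_disc" using f by (simp add: Q_space_def)
  have "(\<integral>\<^sup>+z\<in>unit_disc. ennreal ((cmod (deriv f z))\<^sup>2 * (1 - cmod z) powr s) \<partial>lborel)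
      \<le> (\<integral>\<^sup>+z\<in>unit_disc. ennreal ((cmod (deriv f z))\<^sup>2 * green z 0 powr s) \<partial>lborel)"
  proof (rule nn_integral_mono_AE)
    show "AE z in lborel. ennreal ((cmod (deriv f z))\<^sup>2 * (1 - cmod z) powr s) * indicator unit_disc z
        \<le> ennreal ((cmod (deriv f z))\<^sup>2 * green z 0 powr s) * indicator unit_disc z"
      \<comment> \<open>At the origin the convention \<open>green 0 0 = 0\<close> would break the
        inequality.\<close>
      using AE_lborel_singleton[of "0::complex"]
    proof eventually_elim
      case (elim z)
      show ?case
      proof (cases "z \<in> unit_disc")
        case True
        have "1 - cmod z \<le> green z 0"
          using ln_le_minus_one[of "cmod z"] elim by (simp add: green_def ln_div)
        then have "(1 - cmod z) powr s \<le> green z 0 powr s"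
          using True s by (intro powr_mono2) auto
        then show ?thesis
          using True by (simp add: ennreal_leI mult_left_mono)
      qed simp
    qed
  qed
  also have "\<dots> = ennreal pi * (ennreal (1 / pi) * (\<integral>\<^sup>+z\<in>unit_disc. ennreal ((cmod (deriv f z))\<^sup>2 * green z 0 powr s) \<partial>lborel))"
    by (simp add: mult.assoc[symmetric] flip: ennreal_mult)
  also have "\<dots> = ennreal pi * (\<integral>\<^sup>+z. ennreal ((cmod (deriv f z))\<^sup>2 * green z 0 powr s) \<partial>disc_area)"
    by (simp only: nn_integral_disc_area[OF measurable_deriv_square_times_green[OF hol]])
  also have "\<dots> \<le> ennreal pi * (SUP a\<in>unit_disc. \<integral>\<^sup>+z. ennreal ((cmod (deriv f z))\<^sup>2 * green z a powr s) \<partial>disc_area)"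
    by (intro mult_left_mono SUP_upper) auto
  also have "\<dots> < \<infinity>"
    using f by (simp add: Q_space_def ennreal_mult_less_top)
  finally show ?thesis .
qed

lemma Q_space_if_constant:
  assumes "\<And>z. z \<in> unit_disc \<Longrightarrow> f z = c"
  shows "f \<in> Q_space s"
proof -
  have hol: "f holomorphic_on unit_disc"
    by (rule holomorphic_transform[of "\<lambda>_. c"]) (use assms in auto)
  have deriv: "deriv f z = 0" if "z \<in> unit_disc" for z
  proof -
    have "(f has_field_derivative 0) (at z)"
      by (rule has_field_derivative_transform_within_open[of "\<lambda>_. c" _ _ unit_disc]) (use assms that in auto)
    then show ?thesis by (rule DERIV_imp_deriv)
  qed
  have "(\<integral>\<^sup>+z\<in>unit_disc. ennreal ((cmod (deriv f z))\<^sup>2 * green z a powr s) \<partial>lborel) = (\<integral>\<^sup>+z. 0 \<partial>(lborel::complex measure))" for a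
    by (intro nn_integral_cong) (auto simp: deriv indicator_def)
  then have "(\<integral>\<^sup>+z. ennreal ((cmod (deriv f z))\<^sup>2 * green z a powr s) \<partial>disc_area) = 0" for a
    unfolding nn_integral_disc_area[OF measurable_deriv_square_times_green[OF hol]] by simp
  then show ?thesis
    using hol by (simp add: Q_space_def)
qed

section \<open>The two operators and a common test function\<close>

lemma deriv_I_op:
  assumes "g holomorphic_on unit_disc" "f holomorphic_on unit_disc" "z \<in> unit_disc"
  shows "deriv (I_op g f) z = g z * deriv f z"
proof -
  let ?h = "\<lambda>\<xi>. g \<xi> * deriv f \<xi>"
  have "?h holomorphic_on unit_disc"
    using assms by (intro holomorphic_intros holomorphic_deriv) auto
  then obtain F where F: "\<And>x. x \<in> unit_disc \<Longrightarrow> (F has_field_derivative ?h x) (at x within unit_disc)"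
    by (rule holomorphic_convex_primitive'[OF convex_ball open_ball]) blast
  \<comment> \<open>On the convex disc \<open>g * f'\<close> has a primitive \<open>F\<close>, and
    the integral along the segment is its increment.\<close>
  have eq: "F x - F 0 = I_op g f x" if "x \<in> unit_disc" for x
  proof -
    have "closed_segment 0 x \<subseteq> unit_disc"
      using that by (intro closed_segment_subset) auto
    then have "(?h has_contour_integral F x - F 0) (linepath 0 x)"
      using contour_integral_primitive[of unit_disc F ?h "linepath 0 x"] F by simp
    then show ?thesis
      by (simp add: I_op_def contour_integral_unique)
  qed
  have "((\<lambda>x. F x - F 0) has_field_derivative ?h z) (at z)"
    using DERIV_diff[OF F[OF assms(3)] DERIV_const[of "F 0"]]
    unfolding at_within_open[OF assms(3) open_ball] by simp
  then have "(I_op g f has_field_derivative ?h z) (at z)"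
    by (rule has_field_derivative_transform_within_open[OF _ open_ball assms(3) eq])
  then show ?thesis by (rule DERIV_imp_deriv)
qed

text \<open>The test function depends on the two exponents only and serves every \<open>g\<close>
  and both operators; its boundedness is for \<open>M_op\<close>.\<close>

lemma exists_Q_space_witness:
  assumes s: "0 < s1" "s1 < s2" "s2 \<le> 1"
  obtains f C where "f \<in> Q_space s2" "f holomorphic_on unit_disc" "\<And>z. z \<in> unit_disc \<Longrightarrow> cmod (f z) \<le> C"
    "\<And>g w. \<lbrakk>g holomorphic_on unit_disc; w \<in> unit_disc; g w \<noteq> 0\<rbrakk> \<Longrightarrow>
      (\<integral>\<^sup>+z\<in>unit_disc. ennreal ((cmod (g z * deriv f z))\<^sup>2 * (1 - cmod z) powr s1) \<partial>lborel) = \<infinity>"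
proof -
  \<comment> \<open>These cut the interval from \<open>(1 + s1) / 2\<close> to
    \<open>(1 + s2) / 2\<close> into thirds: \<open>\<alpha>\<close> forces divergence for
    \<open>s1\<close>, \<open>\<beta>\<close> gives membership for \<open>s2\<close>.\<close>
  define \<alpha> \<beta> where "\<alpha> = (1 + s1) / 2 + (s2 - s1) / 6" and "\<beta> = (1 + s1) / 2 + (s2 - s1) / 3"
  have "1 / 2 \<le> \<alpha>" "\<alpha> < \<beta>" "\<beta> \<le> 1" "1 + s1 < 2 * \<alpha>" "s2 \<le> 2 * \<beta>" "2 * \<beta> < 1 + s2"
    using s by (simp_all add: \<alpha>_def \<beta>_def field_simps)
  note ab = this
  obtain f C where f: "f holomorphic_on unit_disc"
    "\<And>z. z \<in> unit_disc \<Longrightarrow> cmod (f z) \<le> C"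
    "\<And>z. z \<in> unit_disc \<Longrightarrow> cmod (deriv f z) \<le> C * (1 - cmod z) powr - \<beta>"
    "\<And>k z. \<lbrakk>1 - 3 / (4 * 10000 ^ k) \<le> cmod z; cmod z \<le> 1 - 1 / (2 * 10000 ^ k)\<rbrakk>
      \<Longrightarrow> (10000 ^ k) powr \<alpha> / 5 \<le> cmod (deriv f z)"
    using exists_lacunary_function[OF ab(1-3)] by blast
  show thesis
  proof
    show "f \<in> Q_space s2"
      using s by (intro Q_space_if_deriv_le[OF f(1) _ _ ab(5,6) f(3)]) auto
    show "(\<integral>\<^sup>+z\<in>unit_disc. ennreal ((cmod (g z * deriv f z))\<^sup>2 * (1 - cmod z) powr s1) \<partial>lborel) = \<infinity>"
      if "g holomorphic_on unit_disc" "w \<in> unit_disc" "g w \<noteq> 0" for g w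
      using weighted_square_integral_infinite[OF that ab(4) _ f(4)] s by simp
  qed (use f in auto)
qed

text \<open>By the product rule \<open>g f' = (g f)' - g' f\<close>; then
  \<open>(x + y)^2 \<le> 2 x^2 + 2 y^2\<close>.\<close>

lemma M_op_deriv_bound:
  assumes g: "g holomorphic_on unit_disc" and f: "f holomorphic_on unit_disc"
    and C: "\<And>z. z \<in> unit_disc \<Longrightarrow> cmod (f z) \<le> C" and z: "z \<in> unit_disc"
  shows "(cmod (g z * deriv f z))\<^sup>2 \<le> 2 * (cmod (deriv (M_op g f) z))\<^sup>2 + 2 * C\<^sup>2 * (cmod (deriv g z))\<^sup>2"
proof -
  have "deriv (M_op g f) z = g z * deriv f z + deriv g z * f z"
    unfolding M_op_def
    by (intro deriv_mult holomorphic_on_imp_differentiable_at[OF g open_ball z] holomorphic_on_imp_differentiable_at[OF f open_ball z])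
  then have "cmod (g z * deriv f z) \<le> cmod (deriv (M_op g f) z) + cmod (deriv g z * f z)"
    using norm_triangle_ineq4[of "deriv (M_op g f) z" "deriv g z * f z"] by simp
  also have "\<dots> \<le> cmod (deriv (M_op g f) z) + C * cmod (deriv g z)"
    using mult_right_mono[OF C[OF z], of "cmod (deriv g z)"] by (simp add: norm_mult mult.commute)
  finally have "(cmod (g z * deriv f z))\<^sup>2 \<le> (cmod (deriv (M_op g f) z) + C * cmod (deriv g z))\<^sup>2"
    by (rule power_mono) simp
  also have "\<dots> \<le> 2 * (cmod (deriv (M_op g f) z))\<^sup>2 + 2 * C\<^sup>2 * (cmod (deriv g z))\<^sup>2"
    using zero_le_power2[of "cmod (deriv (M_op g f) z) - C * cmod (deriv g z)"]
    by (simp add: power2_sum power2_diff power_mult_distrib)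
  finally show ?thesis .
qed

lemma M_op_imp_weighted_square_integral_finite:
  assumes g: "g \<in> Q_space s" and f: "f holomorphic_on unit_disc" and Mf: "M_op g f \<in> Q_space s" and s: "0 < s"
    and C: "\<And>z. z \<in> unit_disc \<Longrightarrow> cmod (f z) \<le> C"
  shows "(\<integral>\<^sup>+z\<in>unit_disc. ennreal ((cmod (g z * deriv f z))\<^sup>2 * (1 - cmod z) powr s) \<partial>lborel) < \<infinity>"
proof -
  have hol: "g holomorphic_on unit_disc" "M_op g f holomorphic_on unit_disc"
    using g Mf by (auto simp: Q_space_def)
  define E where "E F z = ennreal ((cmod (deriv F z))\<^sup>2 * (1 - cmod z) powr s) * indicator unit_disc z" for F z
  have E[measurable]: "E F \<in> borel_measurable borel" if "F holomorphic_on unit_disc" for F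
    unfolding E_def using s
    by (intro measurable_continuous_times_indicator continuous_intros continuous_on_deriv_square that continuous_on_powr') auto
  have "(\<integral>\<^sup>+z\<in>unit_disc. ennreal ((cmod (g z * deriv f z))\<^sup>2 * (1 - cmod z) powr s) \<partial>lborel)
     \<le> (\<integral>\<^sup>+z. ennreal 2 * E (M_op g f) z + ennreal (2 * C\<^sup>2) * E g z \<partial>lborel)"
  proof (rule nn_integral_mono)
    fix z :: complex
    show "ennreal ((cmod (g z * deriv f z))\<^sup>2 * (1 - cmod z) powr s) * indicator unit_disc z
      \<le> ennreal 2 * E (M_op g f) z + ennreal (2 * C\<^sup>2) * E g z"
    proof (cases "z \<in> unit_disc")
      case True
      let ?w = "(1 - cmod z) powr s"
      have "(cmod (g z * deriv f z))\<^sup>2 * ?w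
          \<le> (2 * (cmod (deriv (M_op g f) z))\<^sup>2 + 2 * C\<^sup>2 * (cmod (deriv g z))\<^sup>2) * ?w"
        by (intro mult_right_mono M_op_deriv_bound hol f C True) simp_all
      also have "\<dots> = 2 * ((cmod (deriv (M_op g f) z))\<^sup>2 * ?w) + 2 * C\<^sup>2 * ((cmod (deriv g z))\<^sup>2 * ?w)"
        by (simp add: algebra_simps)
      finally have "ennreal ((cmod (g z * deriv f z))\<^sup>2 * ?w)
          \<le> ennreal (2 * ((cmod (deriv (M_op g f) z))\<^sup>2 * ?w) + 2 * C\<^sup>2 * ((cmod (deriv g z))\<^sup>2 * ?w))"
        by (rule ennreal_leI)
      also have "\<dots> = ennreal 2 * ennreal ((cmod (deriv (M_op g f) z))\<^sup>2 * ?w) + ennreal (2 * C\<^sup>2) * ennreal ((cmod (deriv g z))\<^sup>2 * ?w)"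
        by (subst ennreal_plus) (simp_all add: ennreal_mult)
      finally show ?thesis using True by (simp add: E_def)
    qed simp
  qed
  also have "\<dots> = ennreal 2 * (\<integral>\<^sup>+z. E (M_op g f) z \<partial>lborel) + ennreal (2 * C\<^sup>2) * (\<integral>\<^sup>+z. E g z \<partial>lborel)"
    using hol by (subst nn_integral_add) (simp_all add: nn_integral_cmult)
  also have "\<dots> < \<infinity>"
    using Q_space_imp_dirichlet_finite[OF g s] Q_space_imp_dirichlet_finite[OF Mf s]
    by (simp add: E_def ennreal_mult_less_top)
  finally show ?thesis .
qed

theorem theorem3p2:
  fixes s1 s2 :: real and g :: "complex \<Rightarrow> complex"
  assumes "0 < s1" and "s1 < s2" and "s2 \<le> 1"
    and "g holomorphic_on unit_disc"
  shows "(I_op g ` Q_space s2 \<subseteq> Q_space s1 \<longleftrightarrow> M_op g ` Q_space s2 \<subseteq> Q_space s1) \<and>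
         (M_op g ` Q_space s2 \<subseteq> Q_space s1 \<longleftrightarrow> (\<forall>z\<in>unit_disc. g z = 0))"
proof -
  obtain f C where f: "f \<in> Q_space s2" "f holomorphic_on unit_disc" "\<And>z. z \<in> unit_disc \<Longrightarrow> cmod (f z) \<le> C"
    and *: "\<And>g w. \<lbrakk>g holomorphic_on unit_disc; w \<in> unit_disc; g w \<noteq> 0\<rbrakk> \<Longrightarrow>
      (\<integral>\<^sup>+z\<in>unit_disc. ennreal ((cmod (g z * deriv f z))\<^sup>2 * (1 - cmod z) powr s1) \<partial>lborel) = \<infinity>"
    by (rule exists_Q_space_witness[OF assms(1-3)]) (rule that)
  note infinite = *[OF assms(4)]
  have "I_op g ` Q_space s2 \<subseteq> Q_space s1" "M_op g ` Q_space s2 \<subseteq> Q_space s1"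
    if g0: "\<forall>z\<in>unit_disc. g z = 0"
  proof -
    have "I_op g F z = 0" if "z \<in> unit_disc" for F z
    proof -
      have "closed_segment 0 z \<subseteq> unit_disc"
        using that by (intro closed_segment_subset) auto
      then have "contour_integral (linepath 0 z) (\<lambda>\<xi>. g \<xi> * deriv F \<xi>) = contour_integral (linepath 0 z) (\<lambda>_. 0)"
        using g0 by (intro contour_integral_cong) auto
      then show ?thesis by (simp add: I_op_def)
    qed
    then show "I_op g ` Q_space s2 \<subseteq> Q_space s1"
      by (auto intro!: Q_space_if_constant[where c = 0])
    show "M_op g ` Q_space s2 \<subseteq> Q_space s1"
      using g0 by (auto simp: M_op_def intro!: Q_space_if_constant[where c = 0])
  qed
  moreover have "\<forall>z\<in>unit_disc. g z = 0" if I: "I_op g ` Q_space s2 \<subseteq> Q_space s1"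
  proof (rule ccontr)
    assume "\<not> ?thesis"
    then obtain w where w: "w \<in> unit_disc" "g w \<noteq> 0" by blast
    have "I_op g f \<in> Q_space s1" using I f(1) by blast
    from Q_space_imp_dirichlet_finite[OF this assms(1)]
    have "(\<integral>\<^sup>+z\<in>unit_disc. ennreal ((cmod (deriv (I_op g f) z))\<^sup>2 * (1 - cmod z) powr s1) \<partial>lborel) < \<infinity>" .
    also have "(\<integral>\<^sup>+z\<in>unit_disc. ennreal ((cmod (deriv (I_op g f) z))\<^sup>2 * (1 - cmod z) powr s1) \<partial>lborel)
       = (\<integral>\<^sup>+z\<in>unit_disc. ennreal ((cmod (g z * deriv f z))\<^sup>2 * (1 - cmod z) powr s1) \<partial>lborel)"
      by (intro nn_integral_cong) (auto simp: deriv_I_op[OF assms(4) f(2)] indicator_def)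
    finally show False using infinite[OF w] by simp
  qed
  moreover have "\<forall>z\<in>unit_disc. g z = 0" if M: "M_op g ` Q_space s2 \<subseteq> Q_space s1"
  proof (rule ccontr)
    assume "\<not> ?thesis"
    then obtain w where w: "w \<in> unit_disc" "g w \<noteq> 0" by blast
    \<comment> \<open>Testing on the constant 1 puts \<open>g\<close> itself into
      \<open>Q_space s1\<close>, which controls the term \<open>g' f\<close>.\<close>
    have "M_op g (\<lambda>_. 1) \<in> Q_space s1"
      using M Q_space_if_constant[of "\<lambda>_. 1" 1 s2] by blast
    moreover have "M_op g (\<lambda>_. 1) = g" by (simp add: M_op_def fun_eq_iff)
    ultimately have "g \<in> Q_space s1" by simp
    then show False
      using M_op_imp_weighted_square_integral_finite[OF _ f(2) _ assms(1) f(3), of g] M f(1) infinite[OF w]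
      by auto
  qed
  ultimately show ?thesis by blast
qed

end
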